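(* Let $f_1$ and $f_2$ be probability densities of positive random variables, both satisfying Lin's condition on $(0,+\infty)$. Then there exists a random vector $(\xi_1,\xi_2)$ whose distribution $P$ on $\mathbb{R}^2$ is singular and such that: 1. $\xi_1$ has density $f_1$ and $\xi_2$ has density $f_2$; 2. the product $\xi_1\cdot\xi_2$ has a density $g$ which is continuously differentiable on $(0,+\infty)$ (and non-vanishing there, so that $L_g$ is defined on $(0,+\infty)$); 3. $\displaystyle \limsup_{x\to+\infty} L_g(x)=+\infty$ and $\displaystyle \liminf_{x\to+\infty} L_g(x)=-\infty$.
   Context: A probability distribution on $\mathbb{R}^2$ is called singular if it is singular with respect to two-dimensional Lebesgue measure (i.e. it is concentrated on a Borel set of Lebesgue measure zero). For a probability density $f$ continuously differentiable on $(0,\infty)$, Lin's function of $f$ is $$L_f(x):=-\frac{x f'(x)}{f(x)},$$ defined at points $x$ where $f(x)\neq 0$. Standing convention: all densities considered are densities of positive random variables whose Lin's functions are defined for all $x>0$, i.e. they do not vanish on $(0,\infty)$ (and are zero on $(-\infty,0]$). Let $f\in C^1(0,\infty)$ be a probability density of a positive random variable. For $x_0\ge 0$, $f$ satisfies Lin's condition on $(x_0,\infty)$ if $L_f$ is monotone increasing on $(x_0,\infty)$ and $\lim_{x\to+\infty}L_f(x)=+\infty$. *)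

theory Defs
  imports "HOL-Probability.Probability"
begin

definition lin_fun :: "(real \<Rightarrow> real) \<Rightarrow> real \<Rightarrow> real" where
  "lin_fun f x = - (x * deriv f x / f x)"

(* Probability densities with the standing convention: C^1 on (0,oo), zero on (-oo,0],
   and non-vanishing on (0,oo), so that lin_fun f is a genuine quotient for every x > 0. *)
definition positive_density :: "(real \<Rightarrow> real) \<Rightarrow> bool" where
  "positive_density f \<longleftrightarrow>
     f \<in> borel_measurable borel \<and>
     (\<forall>x. 0 \<le> f x) \<and>
     (\<integral>\<^sup>+ x. ennreal (f x) \<partial>lborel) = 1 \<and>
     (\<forall>x\<le>0. f x = 0) \<and>
     (\<forall>x>0. f x \<noteq> 0) \<and>
     f C1_differentiable_on {0<..}"

(* "Monotone increasing" is read in the non-strict sense. *)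
definition lin_condition :: "real \<Rightarrow> (real \<Rightarrow> real) \<Rightarrow> bool" where
  "lin_condition x0 f \<longleftrightarrow>
     mono_on {x0<..} (lin_fun f) \<and> filterlim (lin_fun f) at_top at_top"

definition lebesgue_singular :: "'a::euclidean_space measure \<Rightarrow> bool" where
  "lebesgue_singular P \<longleftrightarrow>
     (\<exists>A\<in>sets borel. emeasure lborel A = 0 \<and> emeasure P (space P - A) = 0)"

end

(*
  Let r be exponentially distributed and let X and Y be the inverses of the cumulative hazards
  -ln (1 - F1) and -ln (1 - F2), so that X r and Y r have densities f1 and f2.  Perturb the
  comonotone coupling (X r, Y r) by moving a small amount of mass, of relative density w r, from the
  points r and r + 1/2 of the diagonal to the pairs (X r, Y (r + 1/2)) and (X (r + 1/2), Y r).
  The marginals do not change, and the law is carried by three curves, hence singular.  Each curve is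
  mapped by (x, y) |-> x y onto the half-line by a C^2 diffeomorphism, so the product has a
  positive C^1 density g.

  Take w to be a sum of narrow bumps, one at each integer n >= 1, with slope m n / 16 at n.  The
  point X n * Y n has one preimage on each curve: n on the diagonal and two points of (n - 1/2, n) on
  the others; the width 1 / |m n| can be taken so small that w vanishes near the latter.  Then L_g
  at X n * Y n equals alpha n * m n + beta n with alpha n > 0 and alpha, beta independent of m, and it
  suffices to let m n be huge with alternating signs.
*)
theory Submission
  imports Defs
begin

subsection \<open>Diffeomorphisms of the half-line\<close>

text \<open>The arguments \<open>\<Phi>1\<close> and \<open>\<Phi>2\<close> are the first two
  derivatives on the half-line. The value 0 on the other half makes \<open>\<Phi>\<close> monotone,
  hence Borel measurable, on all of the reals.\<close>

definition C2_diffeo :: "(real \<Rightarrow> real) \<Rightarrow> (real \<Rightarrow> real) \<Rightarrow> (real \<Rightarrow> real) \<Rightarrow> bool" where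
  "C2_diffeo \<Phi> \<Phi>1 \<Phi>2 \<longleftrightarrow>
     (\<forall>r\<le>0. \<Phi> r = 0) \<and> \<Phi> ` {0<..} = {0<..} \<and>
     (\<forall>r>0. (\<Phi> has_real_derivative \<Phi>1 r) (at r) \<and> 0 < \<Phi>1 r \<and>
            (\<Phi>1 has_real_derivative \<Phi>2 r) (at r)) \<and>
     continuous_on {0<..} \<Phi>2"

lemma C2_diffeoD:
  assumes "C2_diffeo \<Phi> \<Phi>1 \<Phi>2"
  shows "\<And>r. r \<le> 0 \<Longrightarrow> \<Phi> r = 0"
    and "\<And>r. 0 < r \<Longrightarrow> 0 < \<Phi> r"
    and "\<And>r. 0 < r \<Longrightarrow> (\<Phi> has_real_derivative \<Phi>1 r) (at r)"
    and "\<And>r. 0 < r \<Longrightarrow> 0 < \<Phi>1 r"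
    and "\<And>r. 0 < r \<Longrightarrow> (\<Phi>1 has_real_derivative \<Phi>2 r) (at r)"
    and "continuous_on {0<..} \<Phi>2"
    and "\<And>s. 0 < s \<Longrightarrow> \<exists>r>0. \<Phi> r = s"
proof -
  note D = assms[unfolded C2_diffeo_def]
  show "\<And>r. r \<le> 0 \<Longrightarrow> \<Phi> r = 0"
    and "\<And>r. 0 < r \<Longrightarrow> (\<Phi> has_real_derivative \<Phi>1 r) (at r)"
    and "\<And>r. 0 < r \<Longrightarrow> 0 < \<Phi>1 r"
    and "\<And>r. 0 < r \<Longrightarrow> (\<Phi>1 has_real_derivative \<Phi>2 r) (at r)"
    and "continuous_on {0<..} \<Phi>2"
    using D by blast+
  have surj: "\<Phi> ` {0<..} = {0<..}" using D by blast
  show "\<And>r. 0 < r \<Longrightarrow> 0 < \<Phi> r" using surj by (metis greaterThan_iff imageI)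
  show "\<And>s. 0 < s \<Longrightarrow> \<exists>r>0. \<Phi> r = s" using surj by (metis greaterThan_iff imageE)
qed

lemma C2_diffeo_strict_mono:
  assumes "C2_diffeo \<Phi> \<Phi>1 \<Phi>2" "0 \<le> r" "r < r'"
  shows "\<Phi> r < \<Phi> r'"
proof (cases "r = 0")
  case True
  then show ?thesis using C2_diffeoD(1,2)[OF assms(1)] assms by force
next
  case False
  with assms(2) have "0 < r" by simp
  show ?thesis
  proof (rule DERIV_pos_imp_increasing[OF assms(3)])
    fix x assume "r \<le> x"
    with \<open>0 < r\<close> have "0 < x" by simp
    then show "\<exists>y. (\<Phi> has_real_derivative y) (at x) \<and> 0 < y"
      using C2_diffeoD(3,4)[OF assms(1)] by blast
  qed
qed

lemma C2_diffeo_mono: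
  assumes "C2_diffeo \<Phi> \<Phi>1 \<Phi>2"
  shows "mono \<Phi>"
proof (rule monoI)
  fix x y :: real assume "x \<le> y"
  consider "x \<le> 0" "y \<le> 0" | "x \<le> 0" "0 < y" | "0 < x" "x < y" | "x = y"
    using \<open>x \<le> y\<close> by linarith
  then show "\<Phi> x \<le> \<Phi> y"
  proof cases
    case 2
    then show ?thesis using C2_diffeoD(1)[OF assms, of x] C2_diffeoD(2)[OF assms, of y] by simp
  next
    case 3
    then show ?thesis using C2_diffeo_strict_mono[OF assms, of x y] by simp
  qed (simp_all add: C2_diffeoD(1)[OF assms])
qed

lemma C2_diffeo_measurable:
  "C2_diffeo \<Phi> \<Phi>1 \<Phi>2 \<Longrightarrow> \<Phi> \<in> borel_measurable borel"
  by (rule borel_measurable_mono[OF C2_diffeo_mono])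

lemma C2_diffeo_continuous:
  assumes "C2_diffeo \<Phi> \<Phi>1 \<Phi>2"
  shows "continuous_on {0<..} \<Phi>" "continuous_on {0<..} \<Phi>1"
  using DERIV_isCont[OF C2_diffeoD(3)[OF assms]] DERIV_isCont[OF C2_diffeoD(5)[OF assms]]
  by (simp_all add: continuous_at_imp_continuous_on)

text \<open>Surjectivity needs only arbitrarily small and arbitrarily large values: the image of the
  half-line is connected, so it contains everything between them.\<close>

lemma C2_diffeoI:
  assumes zero: "\<And>r. r \<le> 0 \<Longrightarrow> \<Phi> r = 0"
    and pos: "\<And>r. 0 < r \<Longrightarrow> 0 < \<Phi> r"
    and d1: "\<And>r. 0 < r \<Longrightarrow> (\<Phi> has_real_derivative \<Phi>1 r) (at r)"
    and d1pos: "\<And>r. 0 < r \<Longrightarrow> 0 < \<Phi>1 r"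
    and d2: "\<And>r. 0 < r \<Longrightarrow> (\<Phi>1 has_real_derivative \<Phi>2 r) (at r)"
    and cont: "continuous_on {0<..} \<Phi>2"
    and small: "\<And>s. 0 < s \<Longrightarrow> \<exists>r>0. \<Phi> r \<le> s"
    and large: "\<And>s. 0 < s \<Longrightarrow> \<exists>r>0. s \<le> \<Phi> r"
  shows "C2_diffeo \<Phi> \<Phi>1 \<Phi>2"
proof -
  have "s \<in> \<Phi> ` {0<..}" if "0 < s" for s
  proof -
    obtain a where a: "0 < a" "\<Phi> a \<le> s" using small \<open>0 < s\<close> by blast
    obtain b where b: "0 < b" "s \<le> \<Phi> b" using large \<open>0 < s\<close> by blast
    have "connected (\<Phi> ` {0<..})"
      by (intro connected_continuous_image continuous_at_imp_continuous_on ballI DERIV_isCont[OF d1]) auto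
    then show ?thesis
      using a b connectedD_interval[of "\<Phi> ` {0<..}" "\<Phi> a" "\<Phi> b" s] by simp
  qed
  then have "\<Phi> ` {0<..} = {0<..}" using pos by auto
  then show ?thesis
    unfolding C2_diffeo_def by (intro conjI allI impI assms)
qed

text \<open>The inverse function theorem gives the first derivative, and differentiating
  \<open>1 / \<Phi>1 (\<Psi> s)\<close> by the chain rule gives the second. The case distinctions
  come from the value 0 off the half-line.\<close>

lemma C2_diffeo_inverse:
  assumes D: "C2_diffeo \<Phi> \<Phi>1 \<Phi>2"
  obtains \<Psi> where
    "C2_diffeo \<Psi> (\<lambda>s. 1 / \<Phi>1 (\<Psi> s)) (\<lambda>s. - \<Phi>2 (\<Psi> s) / \<Phi>1 (\<Psi> s) ^ 3)"
    "\<And>r. \<Psi> (\<Phi> r) = (if 0 < r then r else 0)" "\<And>s. \<Phi> (\<Psi> s) = (if 0 < s then s else 0)"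
proof -
  note DD = C2_diffeoD[OF D]
  define \<Psi> where "\<Psi> s = (if 0 < s then SOME r. 0 < r \<and> \<Phi> r = s else 0)" for s
  have \<Psi>: "0 < \<Psi> s" "\<Phi> (\<Psi> s) = s" if "0 < s" for s
    using someI_ex[of "\<lambda>r. 0 < r \<and> \<Phi> r = s"] DD(7)[OF that] that by (auto simp: \<Psi>_def)
  have inv: "\<Psi> (\<Phi> r) = r" if "0 < r" for r
    using \<Psi>[OF DD(2)[OF that]] C2_diffeo_strict_mono[OF D, of r "\<Psi> (\<Phi> r)"]
      C2_diffeo_strict_mono[OF D, of "\<Psi> (\<Phi> r)" r] that by (cases "\<Psi> (\<Phi> r)" r rule: linorder_cases) auto
  have cont: "isCont \<Psi> s" if "0 < s" for s
  proof -
    have "isCont \<Psi> (\<Phi> (\<Psi> s))"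
    proof (rule isCont_inverse_function[where f = \<Phi> and x = "\<Psi> s" and d = "\<Psi> s / 2"])
      show "0 < \<Psi> s / 2" using \<Psi>[OF that] by simp
      fix z assume "\<bar>z - \<Psi> s\<bar> \<le> \<Psi> s / 2"
      then have "0 < z" using \<Psi>[OF that] by arith
      then show "\<Psi> (\<Phi> z) = z" "isCont \<Phi> z" using inv DERIV_isCont[OF DD(3)] by auto
    qed
    then show ?thesis using \<Psi> that by simp
  qed
  have der: "(\<Psi> has_real_derivative 1 / \<Phi>1 (\<Psi> s)) (at s)" if "0 < s" for s
  proof -
    have "(\<Psi> has_real_derivative inverse (\<Phi>1 (\<Psi> s))) (at s)"
    proof (rule DERIV_inverse_function)
      show "(\<Phi> has_real_derivative \<Phi>1 (\<Psi> s)) (at (\<Psi> s))" using DD(3) \<Psi> that by auto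
      show "\<Phi>1 (\<Psi> s) \<noteq> 0" using DD(4)[of "\<Psi> s"] \<Psi> that by auto
      show "0 < s" "s < s + 1" "isCont \<Psi> s" using that cont by auto
      show "\<Phi> (\<Psi> y) = y" if "0 < y" for y using \<Psi>(2)[OF that] .
    qed
    then show ?thesis by (simp add: divide_inverse)
  qed
  have "C2_diffeo \<Psi> (\<lambda>s. 1 / \<Phi>1 (\<Psi> s)) (\<lambda>s. - \<Phi>2 (\<Psi> s) / \<Phi>1 (\<Psi> s) ^ 3)"
  proof (rule C2_diffeoI)
    show "\<Psi> r = 0" if "r \<le> 0" for r using that by (simp add: \<Psi>_def)
    show "0 < \<Psi> s" "0 < 1 / \<Phi>1 (\<Psi> s)" "(\<Psi> has_real_derivative 1 / \<Phi>1 (\<Psi> s)) (at s)" if "0 < s" for s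
      using that \<Psi> DD(4) der by auto
    show "((\<lambda>s. 1 / \<Phi>1 (\<Psi> s)) has_real_derivative - \<Phi>2 (\<Psi> s) / \<Phi>1 (\<Psi> s) ^ 3) (at s)" if "0 < s" for s
    proof -
      have n: "\<Phi>1 (\<Psi> s) \<noteq> 0" using DD(4)[OF \<Psi>(1)[OF that]] by simp
      have "((\<lambda>s. \<Phi>1 (\<Psi> s)) has_real_derivative \<Phi>2 (\<Psi> s) * (1 / \<Phi>1 (\<Psi> s))) (at s)"
        by (rule DERIV_chain2[OF DD(5)[OF \<Psi>(1)[OF that]] der[OF that]])
      from DERIV_inverse_fun[OF this n] show ?thesis
        using n by (simp add: divide_inverse power3_eq_cube power2_eq_square mult_ac)
    qed
    have "continuous_on {0<..} \<Psi>" using cont by (simp add: continuous_at_imp_continuous_on)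
    show "continuous_on {0<..} (\<lambda>s. - \<Phi>2 (\<Psi> s) / \<Phi>1 (\<Psi> s) ^ 3)"
    proof -
      have "\<Psi> ` {0<..} \<subseteq> {0<..}" "\<forall>s\<in>{0<..}. \<Phi>1 (\<Psi> s) ^ 3 \<noteq> 0"
        using \<Psi>(1) DD(4)[OF \<Psi>(1)] by fastforce+
      with \<open>continuous_on {0<..} \<Psi>\<close> show ?thesis
        by (intro continuous_on_divide continuous_on_minus continuous_on_power
            continuous_on_compose2[OF DD(6)] continuous_on_compose2[OF C2_diffeo_continuous(2)[OF D]])
    qed
    \<comment> \<open>The point \<open>\<Phi> s\<close> serves both bounds, as \<open>\<Psi>\<close>
      takes it to \<open>s\<close> exactly.\<close>
    show "\<exists>r>0. \<Psi> r \<le> s" "\<exists>r>0. s \<le> \<Psi> r" if "0 < s" for s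
      using inv[OF that] DD(2)[OF that] by (auto intro!: exI[of _ "\<Phi> s"])
  qed
  moreover have "\<Psi> (\<Phi> r) = (if 0 < r then r else 0)" for r
    using inv DD(1) by (auto simp: \<Psi>_def)
  moreover have "\<Phi> (\<Psi> s) = (if 0 < s then s else 0)" for s
    using \<Psi> DD(1) by (auto simp: \<Psi>_def)
  ultimately show thesis using that by blast
qed

text \<open>The product inherits positivity and monotonicity from its factors. For
  \<open>b > 0\<close> the second factor stays away from 0 near the origin, so the decay of the
  product there comes from \<open>X\<close> alone.\<close>

lemma C2_diffeo_mult_shift:
  assumes X: "C2_diffeo X X1 X2" and Y: "C2_diffeo Y Y1 Y2" and "0 \<le> b"
  shows "C2_diffeo (\<lambda>r. X r * Y (r + b)) (\<lambda>r. X1 r * Y (r + b) + X r * Y1 (r + b))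
    (\<lambda>r. X2 r * Y (r + b) + 2 * X1 r * Y1 (r + b) + X r * Y2 (r + b))"
proof -
  note XD = C2_diffeoD[OF X] and YD = C2_diffeoD[OF Y]
  have pos: "0 < r + b" if "0 < r" for r using that assms(3) by simp
  have Yd: "((\<lambda>r. Y (r + b)) has_real_derivative Y1 (r + b)) (at r)"
    "((\<lambda>r. Y1 (r + b)) has_real_derivative Y2 (r + b)) (at r)" if "0 < r" for r
    using YD(3,5)[OF pos[OF that]] by (simp_all add: DERIV_shift)
  have sub: "(\<lambda>r. r + b) ` {0<..} \<subseteq> {0<..}" using pos by auto
  show ?thesis
  proof (rule C2_diffeoI)
    show "X r * Y (r + b) = 0" if "r \<le> 0" for r using that XD(1) by simp
    show "0 < X r * Y (r + b)" "0 < X1 r * Y (r + b) + X r * Y1 (r + b)" if "0 < r" for r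
      using XD(2,4)[OF that] YD(2,4)[OF pos[OF that]] by (simp_all add: add_pos_pos)
    show "((\<lambda>r. X r * Y (r + b)) has_real_derivative X1 r * Y (r + b) + X r * Y1 (r + b)) (at r)"
      if "0 < r" for r
      by (rule derivative_eq_intros XD(3) Yd that refl)+ (simp add: algebra_simps)
    show "((\<lambda>r. X1 r * Y (r + b) + X r * Y1 (r + b)) has_real_derivative
        X2 r * Y (r + b) + 2 * X1 r * Y1 (r + b) + X r * Y2 (r + b)) (at r)" if "0 < r" for r
      by (rule derivative_eq_intros XD(3,5) Yd that refl)+ (simp add: algebra_simps)
    show "continuous_on {0<..} (\<lambda>r. X2 r * Y (r + b) + 2 * X1 r * Y1 (r + b) + X r * Y2 (r + b))"
      by (intro continuous_intros XD(6) C2_diffeo_continuous[OF X] sub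
          continuous_on_compose2[OF YD(6)] continuous_on_compose2[OF C2_diffeo_continuous(1)[OF Y]]
          continuous_on_compose2[OF C2_diffeo_continuous(2)[OF Y]])
    show "\<exists>r>0. X r * Y (r + b) \<le> s" if "0 < s" for s
    proof -
      have Yp: "0 < Y (1 + b)" using YD(2) pos by simp
      then obtain r where r: "0 < r" "X r = s / Y (1 + b)"
        using XD(7)[of "s / Y (1 + b)"] \<open>0 < s\<close> by auto
      \<comment> \<open>Capping the parameter at 1 bounds the second factor by
        \<open>Y (1 + b)\<close>, and \<open>r\<close> was chosen to make \<open>X r\<close> times
        this bound equal to \<open>s\<close>. The lower bound further down uses the maximum in the
        same way.\<close>
      define q where "q = min r 1"
      have q: "0 < q" "q \<le> r" "q \<le> 1" using r by (auto simp: q_def)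
      have "X q \<le> X r"
        using monoD[OF C2_diffeo_mono[OF X]] q by blast
      moreover have "Y (q + b) \<le> Y (1 + b)"
        using monoD[OF C2_diffeo_mono[OF Y], of "q + b" "1 + b"] q by simp
      ultimately have "X q * Y (q + b) \<le> X r * Y (1 + b)"
        using XD(2)[of r] YD(2)[of "q + b"] r(1) q pos[of q] by (intro mult_mono) auto
      also have "\<dots> = s" using r Yp by simp
      finally show ?thesis using q by blast
    qed
    show "\<exists>r>0. s \<le> X r * Y (r + b)" if "0 < s" for s
    proof -
      have Yp: "0 < Y (1 + b)" using YD(2) pos by simp
      then obtain r where r: "0 < r" "X r = s / Y (1 + b)"
        using XD(7)[of "s / Y (1 + b)"] \<open>0 < s\<close> by auto
      define q where "q = max r 1"
      have q: "0 < q" "r \<le> q" "1 \<le> q" using r by (auto simp: q_def)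
      have "X r \<le> X q"
        using monoD[OF C2_diffeo_mono[OF X]] q by blast
      moreover have "Y (1 + b) \<le> Y (q + b)"
        using monoD[OF C2_diffeo_mono[OF Y], of "1 + b" "q + b"] q by simp
      ultimately have "X r * Y (1 + b) \<le> X q * Y (q + b)"
        using XD(2)[of q] q Yp by (intro mult_mono) auto
      moreover have "X r * Y (1 + b) = s" using r Yp by simp
      ultimately have "s \<le> X q * Y (q + b)" by simp
      then show ?thesis using q by blast
    qed
  qed
qed

text \<open>This is the substitution rule on compact intervals, extended to the open half-line by
  exhaustion and continuity from below of the measures \<open>L\<close> and
  \<open>R\<close>.\<close>

lemma nn_integral_C2_diffeo:
  assumes D: "C2_diffeo \<Psi> \<Psi>1 \<Psi>2" and F [measurable]: "F \<in> borel_measurable borel"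
  shows "(\<integral>\<^sup>+r. F r * indicator {0<..} r \<partial>lborel) =
         (\<integral>\<^sup>+s. F (\<Psi> s) * ennreal (\<Psi>1 s) * indicator {0<..} s \<partial>lborel)"
proof -
  note DD = C2_diffeoD[OF D]
  note [measurable] = C2_diffeo_measurable[OF D]
  \<comment> \<open>The derivative \<open>\<Psi>1\<close> is controlled only on the half-line; the
    cut-off makes it globally measurable.\<close>
  define q where "q s = indicator {0<..} s *\<^sub>R \<Psi>1 s" for s
  have [measurable]: "q \<in> borel_measurable borel"
    unfolding q_def
    by (intro borel_measurable_continuous_on_indicator C2_diffeo_continuous(2)[OF D]) simp
  define L where "L = density lborel F"
  define R where "R = density lborel (\<lambda>s. F (\<Psi> s) * ennreal (q s))"
  \<comment> \<open>The offset 2 keeps the interval from \<open>c n\<close> to \<open>n + 1\<close>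
    nondegenerate already at \<open>n = 0\<close>.\<close>
  define c :: "nat \<Rightarrow> real" where "c n = 1 / real (n + 2)" for n
  have c: "0 < c n" "c n < real n + 1" for n
  proof -
    show "0 < c n" by (simp add: c_def)
    have "c n \<le> 1 / 2" unfolding c_def by (rule divide_left_mono) auto
    then show "c n < real n + 1" by linarith
  qed
  have cdec: "c n \<le> c m" if "m \<le> n" for m n
    unfolding c_def by (rule divide_left_mono) (use that in auto)
  have mono: "\<Psi> a \<le> \<Psi> b" if "a \<le> b" for a b
    using monoD[OF C2_diffeo_mono[OF D] that] .
  have eq: "emeasure L {\<Psi> (c n)..\<Psi> (real n + 1)} = emeasure R {c n..real n + 1}" for n
  proof -
    have "emeasure L {\<Psi> (c n)..\<Psi> (real n + 1)} =
        (\<integral>\<^sup>+x. F x * indicator {\<Psi> (c n)..\<Psi> (real n + 1)} x \<partial>lborel)"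
      unfolding L_def by (subst emeasure_density) auto
    also have "\<dots> = (\<integral>\<^sup>+x. F (\<Psi> x) * ennreal (\<Psi>1 x) * indicator {c n..real n + 1} x \<partial>lborel)"
    proof (rule nn_integral_substitution_aux)
      show "(\<Psi> has_real_derivative \<Psi>1 x) (at x)" "0 \<le> \<Psi>1 x" if "x \<in> {c n..real n + 1}" for x
        using that c(1)[of n] DD(3,4)[of x] by (auto simp: less_imp_le)
      show "continuous_on {c n..real n + 1} \<Psi>1"
        by (rule continuous_on_subset[OF C2_diffeo_continuous(2)[OF D]]) (use c(1)[of n] in auto)
    qed (use c in auto)
    also have "\<dots> = (\<integral>\<^sup>+x. F (\<Psi> x) * ennreal (q x) * indicator {c n..real n + 1} x \<partial>lborel)"
      by (rule nn_integral_cong) (use c(1)[of n] in \<open>auto simp: q_def split: split_indicator\<close>)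
    also have "\<dots> = emeasure R {c n..real n + 1}"
      unfolding R_def by (subst emeasure_density) auto
    finally show ?thesis .
  qed
  have Un: "(\<Union>n. {c n..real n + 1}) = {0<..}"
  proof (intro equalityI subsetI)
    fix x :: real assume "x \<in> {0<..}"
    then have x: "0 < x" by simp
    obtain n where n: "x \<le> real n" using real_arch_simple by blast
    obtain m where m: "0 < m" "1 / real m < x"
      using ex_inverse_of_nat_less[OF x] by (auto simp: divide_inverse)
    have "c (max n m) \<le> 1 / real m" using m by (auto simp: c_def intro!: frac_le)
    with m n have "x \<in> {c (max n m)..real (max n m) + 1}" by auto
    then show "x \<in> (\<Union>n. {c n..real n + 1})" by blast
  qed (use c(1) in \<open>auto intro: less_le_trans\<close>)
  have Un': "(\<Union>n. {\<Psi> (c n)..\<Psi> (real n + 1)}) = {0<..}"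
  proof (intro equalityI subsetI)
    fix s :: real assume "s \<in> {0<..}"
    then obtain r where r: "0 < r" "\<Psi> r = s" using DD(7) by auto
    then have "r \<in> (\<Union>n. {c n..real n + 1})" using Un by simp
    then obtain n where "c n \<le> r" "r \<le> real n + 1" by auto
    then show "s \<in> (\<Union>n. {\<Psi> (c n)..\<Psi> (real n + 1)})" using mono r(2) by auto
  qed (use c(1) DD(2) in \<open>auto intro: less_le_trans\<close>)
  have "(SUP n. emeasure R {c n..real n + 1}) = emeasure R (\<Union>n. {c n..real n + 1})"
  proof (rule SUP_emeasure_incseq)
    show "incseq (\<lambda>n. {c n..real n + 1})"
      unfolding incseq_def using cdec by (auto intro: order_trans)
  qed (auto simp: R_def)
  moreover have "(SUP n. emeasure L {\<Psi> (c n)..\<Psi> (real n + 1)}) = emeasure L (\<Union>n. {\<Psi> (c n)..\<Psi> (real n + 1)})"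
  proof (rule SUP_emeasure_incseq)
    have "\<Psi> (c n) \<le> \<Psi> (c m)" "\<Psi> (real m + 1) \<le> \<Psi> (real n + 1)" if "m \<le> n" for m n
      using that mono cdec by auto
    then show "incseq (\<lambda>n. {\<Psi> (c n)..\<Psi> (real n + 1)})"
      unfolding incseq_def by (auto intro: order_trans)
  qed (auto simp: L_def)
  ultimately have "emeasure L {0<..} = emeasure R {0<..}" using eq Un Un' by simp
  then have "(\<integral>\<^sup>+r. F r * indicator {0<..} r \<partial>lborel) =
         (\<integral>\<^sup>+s. F (\<Psi> s) * ennreal (q s) * indicator {0<..} s \<partial>lborel)"
    unfolding L_def R_def by (simp add: emeasure_density)
  also have "\<dots> = (\<integral>\<^sup>+s. F (\<Psi> s) * ennreal (\<Psi>1 s) * indicator {0<..} s \<partial>lborel)"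
    by (rule nn_integral_cong) (simp add: q_def split: split_indicator)
  finally show ?thesis .
qed

lemma C2_diffeo_at_top:
  assumes "C2_diffeo \<Phi> \<Phi>1 \<Phi>2"
  shows "filterlim \<Phi> at_top at_top"
  unfolding filterlim_at_top
proof
  fix Z :: real
  have "0 < max Z 1" by simp
  from C2_diffeoD(7)[OF assms this] obtain r where r: "0 < r" "\<Phi> r = max Z 1" by blast
  show "\<forall>\<^sub>F x in at_top. Z \<le> \<Phi> x"
    using eventually_ge_at_top[of r]
  proof eventually_elim
    case (elim x)
    then show ?case using monoD[OF C2_diffeo_mono[OF assms] elim] r by linarith
  qed
qed

subsection \<open>Oscillating functions and bump trains\<close>

text \<open>Every property that holds eventually at infinity holds at \<open>s k\<close> for all
  large \<open>k\<close>, where \<open>f\<close> is at least \<open>k\<close>; so each supremum in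
  the definition of the upper limit is infinite.\<close>

lemma Limsup_ereal_eq_PInfty:
  fixes f :: "real \<Rightarrow> real" and s :: "nat \<Rightarrow> real"
  assumes s: "filterlim s at_top sequentially" and f: "\<And>n. real n \<le> f (s n)"
  shows "Limsup at_top (\<lambda>x. ereal (f x)) = \<infinity>"
proof -
  have "(SUP x\<in>Collect P. ereal (f x)) = \<infinity>" if "eventually P at_top" for P :: "real \<Rightarrow> bool"
  proof (rule SUP_PInfty)
    fix n :: nat
    have "eventually (\<lambda>k. P (s k) \<and> n \<le> k) sequentially"
      using filterlim_iff[THEN iffD1, OF s, rule_format, OF that] eventually_ge_at_top[of n]
      by eventually_elim simp
    then obtain k where "P (s k)" "n \<le> k"
      using eventually_happens by force
    with f[of k] show "\<exists>i\<in>Collect P. ereal (real n) \<le> ereal (f i)"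
      by (intro bexI[of _ "s k"]) auto
  qed
  then have "\<infinity> \<le> Limsup at_top (\<lambda>x. ereal (f x))"
    unfolding Limsup_def by (intro INF_greatest) simp
  then show ?thesis by simp
qed

lemma Liminf_ereal_eq_MInfty:
  fixes f :: "real \<Rightarrow> real" and s :: "nat \<Rightarrow> real"
  assumes "filterlim s at_top sequentially" "\<And>n. f (s n) \<le> - real n"
  shows "Liminf at_top (\<lambda>x. ereal (f x)) = - \<infinity>"
proof -
  have "real n \<le> - f (s n)" for n using assms(2)[of n] by simp
  from Limsup_ereal_eq_PInfty[OF assms(1) this]
  have "- Liminf at_top (\<lambda>x. ereal (f x)) = \<infinity>"
    using ereal_Limsup_uminus[of at_top "\<lambda>x. ereal (f x)"] by simp
  then show ?thesis by (simp add: ereal_uminus_eq_reorder)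
qed

lemma has_real_derivative_max_power2:
  "((\<lambda>t. (max 0 t)\<^sup>2) has_real_derivative 2 * max 0 t) (at t)"
proof -
  consider "t < 0" | "t = 0" | "0 < t" by linarith
  then show ?thesis
  proof cases
    case 1
    have "((\<lambda>t. 0) has_real_derivative 0) (at t)" by simp
    then have "((\<lambda>t. (max 0 t)\<^sup>2) has_real_derivative 0) (at t)"
      by (rule has_field_derivative_transform_within_open[of _ _ _ "{..<0}"]) (use 1 in auto)
    with 1 show ?thesis by simp
  next
    case 2
    \<comment> \<open>Caratheodory's criterion at the corner: the slope function is the positive
      part itself, continuous with value 0.\<close>
    have "\<exists>g. (\<forall>z::real. (max 0 z)\<^sup>2 - (max 0 0)\<^sup>2 = g z * (z - 0)) \<and> isCont g 0 \<and> g 0 = 0"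
      by (intro exI[of _ "\<lambda>z. max 0 z"]) (auto simp: power2_eq_square continuous_max)
    then show ?thesis unfolding 2 by (simp add: CARAT_DERIV)
  next
    case 3
    have "((\<lambda>t. t\<^sup>2) has_real_derivative 2 * t) (at t)" by (auto intro!: derivative_eq_intros)
    then have "((\<lambda>t. (max 0 t)\<^sup>2) has_real_derivative 2 * t) (at t)"
      by (rule has_field_derivative_transform_within_open[of _ _ _ "{0<..}"]) (use 3 in auto)
    with 3 show ?thesis by simp
  qed
qed

text \<open>The square of a positive part gives a C^1 profile supported in [-1, 1]. The factor
  \<open>1 + z\<close>, nonnegative there, produces a nonzero slope at the centre, and 16 normalises
  the upper bound to 1/8.\<close>

definition bump :: "real \<Rightarrow> real" where
  "bump z = (max 0 (1 - z\<^sup>2))\<^sup>2 * (1 + z) / 16"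

definition bump' :: "real \<Rightarrow> real" where
  "bump' z = ((max 0 (1 - z\<^sup>2))\<^sup>2 - 4 * z * (1 + z) * max 0 (1 - z\<^sup>2)) / 16"

lemma bump_deriv: "(bump has_real_derivative bump' z) (at z)"
proof -
  have "((\<lambda>z. (max 0 (1 - z\<^sup>2))\<^sup>2) has_real_derivative (2 * max 0 (1 - z\<^sup>2)) * (- (2 * z))) (at z)"
    by (rule DERIV_chain2[OF has_real_derivative_max_power2]) (auto intro!: derivative_eq_intros)
  moreover have "((\<lambda>z. 1 + z) has_real_derivative 1) (at z)"
    by (auto intro!: derivative_eq_intros)
  ultimately have "((\<lambda>z. (max 0 (1 - z\<^sup>2))\<^sup>2 * (1 + z)) has_real_derivative
     (2 * max 0 (1 - z\<^sup>2)) * (- (2 * z)) * (1 + z) + 1 * (max 0 (1 - z\<^sup>2))\<^sup>2) (at z)"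
    by (rule DERIV_mult)
  from DERIV_cdivide[OF this, of 16] show ?thesis
    unfolding bump_def[abs_def] bump'_def by (simp add: algebra_simps)
qed

lemma bump_zero:
  assumes "1 \<le> \<bar>z\<bar>"
  shows "bump z = 0" "bump' z = 0"
proof -
  have "1 \<le> z\<^sup>2" using assms by (metis one_le_power power2_abs)
  then show "bump z = 0" "bump' z = 0" by (simp_all add: bump_def bump'_def max_def)
qed

lemma bump_bounds: "0 \<le> bump z" "bump z \<le> 1 / 8"
proof -
  have "0 \<le> bump z \<and> bump z \<le> 1 / 8"
  proof (cases "1 \<le> \<bar>z\<bar>")
    case False
    then have z: "0 \<le> 1 + z" "1 + z \<le> 2" "z\<^sup>2 \<le> 1" by (auto simp: abs_square_le_1)
    then have "(1 - z\<^sup>2)\<^sup>2 \<le> 1" by (simp add: abs_square_le_1)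
    with z have "(1 - z\<^sup>2)\<^sup>2 * (1 + z) \<le> 1 * 2" by (intro mult_mono) auto
    with z show ?thesis by (simp add: bump_def max_def mult.commute)
  qed (simp add: bump_zero)
  then show "0 \<le> bump z" "bump z \<le> 1 / 8" by auto
qed

lemma bump_at_0: "bump 0 = 1 / 16" "bump' 0 = 1 / 16"
  by (simp_all add: bump_def bump'_def)

text \<open>Put \<open>bump (m n * (r - n))\<close> around each integer \<open>n \<ge> 1\<close>.
  Rescaling the argument keeps the height and multiplies the slope by \<open>m n\<close>, sign
  included; the half-width is at most 1/4, so the supports are disjoint.\<close>

lemma exists_bump_train:
  fixes m :: "int \<Rightarrow> real"
  assumes m: "\<And>n. 4 \<le> \<bar>m n\<bar>"
  obtains w w' :: "real \<Rightarrow> real" where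
    "\<And>r. (w has_real_derivative w' r) (at r)" "continuous_on UNIV w'"
    "\<And>r. 0 \<le> w r" "\<And>r. w r \<le> 1 / 8" "\<And>r. r \<le> 0 \<Longrightarrow> w r = 0"
    "\<And>n. 1 \<le> n \<Longrightarrow> w (of_int n) = 1 / 16" "\<And>n. 1 \<le> n \<Longrightarrow> w' (of_int n) = m n / 16"
    "\<And>n r. 1 / \<bar>m n\<bar> \<le> \<bar>r - of_int n\<bar> \<Longrightarrow> \<bar>r - of_int n\<bar> \<le> 1 / 2 \<Longrightarrow> w r = 0 \<and> w' r = 0"
proof -
  \<comment> \<open>One template for both functions: \<open>c = 1\<close> with \<open>bump\<close>
    gives \<open>w\<close>, and \<open>c = m\<close> with \<open>bump'\<close> gives its
    derivative.\<close>
  define T :: "(int \<Rightarrow> real) \<Rightarrow> (real \<Rightarrow> real) \<Rightarrow> int \<Rightarrow> real \<Rightarrow> real" where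
    "T c g n r = (if 1 \<le> n then c n * g (m n * (r - of_int n)) else 0)" for c g n r
  have T0: "T c g n r = 0" if g: "\<And>z. 1 \<le> \<bar>z\<bar> \<Longrightarrow> g z = 0" and "1 / 4 \<le> \<bar>r - of_int n\<bar>" for c g n r
  proof -
    have "4 * (1 / 4) \<le> \<bar>m n\<bar> * \<bar>r - of_int n\<bar>" using m[of n] that by (intro mult_mono) auto
    then show ?thesis using g by (simp add: T_def abs_mult)
  qed
  \<comment> \<open>Near \<open>r0\<close> the nearest integer may jump, but then \<open>r\<close>
    is at least 1/4 away from both integers and both terms vanish. Hence locally a single fixed bump
    describes the train, and its regularity carries over.\<close>
  have loc: "T c g (round r) r = T c g (round r0) r"
    if g: "\<And>z. 1 \<le> \<bar>z\<bar> \<Longrightarrow> g z = 0" and r: "\<bar>r - r0\<bar> < 1 / 4" for c g r r0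
  proof (cases "round r = round r0")
    case False
    have a: "\<bar>of_int (round r) - r\<bar> \<le> 1 / 2" "\<bar>of_int (round r0) - r0\<bar> \<le> 1 / 2"
      by (rule of_int_round_abs_le)+
    have "1 \<le> \<bar>round r - round r0\<bar>" using False by linarith
    then have "1 \<le> \<bar>real_of_int (round r) - of_int (round r0)\<bar>"
      by (metis of_int_1_le_iff of_int_abs of_int_diff)
    then have "1 / 4 \<le> \<bar>r - of_int (round r)\<bar>" "1 / 4 \<le> \<bar>r - of_int (round r0)\<bar>"
      using a r by linarith+
    then show ?thesis using T0[of g r "round r" c] T0[of g r "round r0" c] g by simp
  qed simp
  define w where "w r = T (\<lambda>_. 1) bump (round r) r" for r
  define w' where "w' r = T m bump' (round r) r" for r
  have "(w has_real_derivative w' r) (at r)" for r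
  proof (rule has_field_derivative_transform_within_open)
    have "((\<lambda>s. bump (m n * (s - of_int n))) has_real_derivative bump' (m n * (r - of_int n)) * m n) (at r)" for n
      by (rule DERIV_chain2[OF bump_deriv]) (auto intro!: derivative_eq_intros)
    then show "(T (\<lambda>_. 1) bump (round r) has_real_derivative w' r) (at r)"
      unfolding T_def[abs_def] w'_def by (auto simp: mult.commute)
    show "open {r - 1/4<..<r + 1/4}" "r \<in> {r - 1/4<..<r + 1/4}" by auto
    show "T (\<lambda>_. 1) bump (round r) s = w s" if "s \<in> {r - 1/4<..<r + 1/4}" for s
    proof -
      have "r - 1 / 4 < s" "s < r + 1 / 4" using that by auto
      then have "\<bar>s - r\<bar> < 1 / 4" by linarith
      then show ?thesis
        unfolding w_def by (intro loc[symmetric]) (simp_all add: bump_zero)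
    qed
  qed
  moreover have "continuous_on UNIV w'"
  proof (rule continuous_at_imp_continuous_on, rule ballI)
    fix r :: real
    have "continuous_on UNIV bump'"
      unfolding bump'_def[abs_def] by (intro continuous_intros) auto
    then have "continuous_on UNIV (\<lambda>s. bump' (m n * (s - of_int n)))" for n
      by (rule continuous_on_compose2) (auto intro!: continuous_intros)
    then have "continuous_on UNIV (T m bump' (round r))"
      unfolding T_def[abs_def] by (cases "1 \<le> round r") (simp_all add: continuous_on_mult_left)
    then have "isCont (T m bump' (round r)) r"
      by (simp add: continuous_on_eq_continuous_at)
    moreover have "eventually (\<lambda>s. s \<in> {r - 1/4<..<r + 1/4}) (nhds r)"
      by (rule eventually_nhds_in_open) auto
    then have "eventually (\<lambda>s. w' s = T m bump' (round r) s) (nhds r)"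
    proof eventually_elim
      case (elim s)
      have "r - 1 / 4 < s" "s < r + 1 / 4" using elim by auto
      then have "\<bar>s - r\<bar> < 1 / 4" by linarith
      then show ?case
        unfolding w'_def by (intro loc) (simp_all add: bump_zero)
    qed
    ultimately show "isCont w' r" by (simp add: isCont_cong)
  qed
  moreover have "0 \<le> w r" "w r \<le> 1 / 8" for r
    using bump_bounds by (simp_all add: w_def T_def)
  moreover have "w r = 0" if "r \<le> 0" for r
  proof -
    have "round r \<le> 0" using round_mono[OF that] by simp
    then show ?thesis by (simp add: w_def T_def)
  qed
  moreover have "w (of_int n) = 1 / 16" "w' (of_int n) = m n / 16" if "1 \<le> n" for n
    using that by (simp_all add: w_def w'_def T_def bump_at_0)
  moreover have "w r = 0 \<and> w' r = 0"
    if "1 / \<bar>m n\<bar> \<le> \<bar>r - of_int n\<bar>" "\<bar>r - of_int n\<bar> \<le> 1 / 2" for n r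
  proof (cases "round r = n")
    case True
    have "0 < \<bar>m n\<bar>" using m[of n] by linarith
    then have "1 \<le> \<bar>r - of_int n\<bar> * \<bar>m n\<bar>"
      using that(1) pos_divide_le_eq by blast
    then have "1 \<le> \<bar>m n * (r - of_int n)\<bar>" by (simp add: abs_mult mult.commute)
    then show ?thesis using True by (simp add: w_def w'_def T_def bump_zero)
  next
    case False
    \<comment> \<open>Only a tie at distance exactly 1/2 remains; there \<open>r\<close> is also far
      from the integer to which it is rounded.\<close>
    have "round r = n" if "\<bar>r - of_int n\<bar> < 1 / 2" using round_unique'[OF that] .
    with False that(2) have "\<bar>r - of_int n\<bar> = 1 / 2" by argo
    moreover have "1 \<le> \<bar>round r - n\<bar>" using False by linarith
    then have "1 \<le> \<bar>real_of_int (round r) - of_int n\<bar>"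
      by (metis of_int_1_le_iff of_int_abs of_int_diff)
    ultimately have "1 / 4 \<le> \<bar>r - of_int (round r)\<bar>" by linarith
    then show ?thesis unfolding w_def w'_def by (intro conjI T0) (simp_all add: bump_zero)
  qed
  ultimately show thesis by (rule that)
qed

subsection \<open>The cumulative hazard of a density\<close>

text \<open>Take the cumulative hazard \<open>- ln (1 - F)\<close> of the distribution function
  \<open>F\<close>. Its derivative is \<open>f / (1 - F)\<close>, which gives the stated identity,
  and positivity of \<open>f\<close> keeps \<open>F\<close> strictly between 0 and 1 on the
  half-line.\<close>

lemma C2_diffeo_hazard:
  assumes f: "positive_density f"
  obtains H H1 H2 where "C2_diffeo H H1 H2" "\<And>x. 0 < x \<Longrightarrow> exp (- H x) * H1 x = f x"
proof -
  have fm [measurable]: "f \<in> borel_measurable borel" and nn: "\<And>x. 0 \<le> f x"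
    and int1: "(\<integral>\<^sup>+x. ennreal (f x) \<partial>lborel) = 1" and f0: "\<And>x. x \<le> 0 \<Longrightarrow> f x = 0"
    and f_ne: "\<And>x. 0 < x \<Longrightarrow> f x \<noteq> 0" and C1: "f C1_differentiable_on {0<..}"
    using f by (auto simp: positive_density_def)
  have fpos: "0 < f x" if "0 < x" for x using nn[of x] f_ne[OF that] by simp
  obtain f' where f': "\<And>x. 0 < x \<Longrightarrow> (f has_real_derivative f' x) (at x)" "continuous_on {0<..} f'"
    using C1 unfolding C1_differentiable_on_def has_real_derivative_iff_has_vector_derivative by auto
  have fcont: "continuous_on {0<..} f"
    using DERIV_isCont[OF f'(1)] by (simp add: continuous_at_imp_continuous_on)
  define N where "N = density lborel (\<lambda>x. ennreal (f x))"
  have "prob_space N"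
    by (rule prob_spaceI) (use int1 in \<open>simp add: N_def emeasure_density\<close>)
  then interpret N: prob_space N .
  interpret N: real_distribution N by standard (simp add: N_def)
  define F where "F = cdf N"
  have F0: "F x = 0" if "x \<le> 0" for x
  proof -
    have "emeasure N {..x} = (\<integral>\<^sup>+y. ennreal (f y) * indicator {..x} y \<partial>lborel)"
      unfolding N_def by (rule emeasure_density) auto
    also have "\<dots> = (\<integral>\<^sup>+y. 0 \<partial>(lborel :: real measure))"
      by (intro nn_integral_cong) (use f0 that in \<open>auto split: split_indicator\<close>)
    finally show ?thesis by (simp add: F_def cdf_def measure_def)
  qed
  have Fd: "(F has_real_derivative f x) (at x)" if x: "0 < x" for x
  proof -
    \<comment> \<open>The density may be unbounded at 0, so the fundamental theorem of calculus is
      applied on a compact interval around \<open>x\<close>. The margin between \<open>a0\<close>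
      and \<open>a\<close> makes \<open>G\<close> differentiable on both sides of
      \<open>a\<close>.\<close>
    define a0 a b where "a0 = x / 4" and "a = x / 2" and "b = x + 1"
    have ab: "0 < a0" "a0 < a" "a < x" "x < b" using x by (auto simp: a0_def a_def b_def)
    have cab: "continuous_on {a0..b} f" by (rule continuous_on_subset[OF fcont]) (use ab in auto)
    define G where "G u = integral {a0..u} f" for u
    have G: "(G has_real_derivative f t) (at t)" if t: "a0 < t" "t < b" for t
      using integral_has_real_derivative[OF cab, of t] t at_within_Icc_at[OF t]
      by (simp add: G_def[abs_def])
    have Feq: "F u = measure N {..<a} + (G u - G a)" if u: "u \<in> {a<..<b}" for u
    proof -
      have "emeasure N {a..u} = (\<integral>\<^sup>+y. ennreal (f y) * indicator {a..u} y \<partial>lborel)"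
        unfolding N_def by (rule emeasure_density) auto
      also have "\<dots> = ennreal (G u - G a)"
      proof (rule nn_integral_FTC_Icc)
        show "(G has_real_derivative f y) (at y)" if "y \<in> {a..u}" for y
          using G[of y] that u ab by simp
      qed (use u nn in auto)
      finally have "emeasure N {a..u} = ennreal (G u - G a)" .
      moreover have "G a \<le> G u"
      proof (rule DERIV_nonneg_imp_nondecreasing[where f = G])
        show "a \<le> u" using u by simp
        show "\<exists>d. (G has_real_derivative d) (at y) \<and> 0 \<le> d" if "a \<le> y" "y \<le> u" for y
          using G[of y] nn[of y] that u ab by auto
      qed
      ultimately have m: "measure N {a..u} = G u - G a" by (simp add: measure_def)
      have "measure N ({..<a} \<union> {a..u}) = measure N {..<a} + measure N {a..u}"
        by (rule N.finite_measure_Union) auto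
      moreover have "{..<a} \<union> {a..u} = {..u}" using u by auto
      ultimately show ?thesis by (simp add: F_def cdf_def m)
    qed
    have "(G has_real_derivative f x) (at x)"
      using G[of x] ab by simp
    then have "((\<lambda>u. measure N {..<a} + (G u - G a)) has_real_derivative f x) (at x)"
      by (auto intro!: derivative_eq_intros)
    then show ?thesis
      by (rule has_field_derivative_transform_within_open[of _ _ _ "{a<..<b}"]) (use ab Feq in auto)
  qed
  have Fmono: "F x < F y" if "0 < x" "x < y" for x y
  proof (rule DERIV_pos_imp_increasing[OF that(2)])
    fix z assume "x \<le> z"
    then have "0 < z" using that by simp
    then show "\<exists>d. (F has_real_derivative d) (at z) \<and> 0 < d" using Fd fpos by blast
  qed
  have Fpos: "0 < F x" if "0 < x" for x
    using Fmono[of "x / 2" x] N.cdf_nonneg[of "x / 2"] that by (simp add: F_def)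
  have Flt: "F x < 1" if "0 < x" for x
    using Fmono[of x "x + 1"] N.cdf_bounded_prob[of "x + 1"] that by (simp add: F_def)
  define H where "H x = - ln (1 - F x)" for x
  define H1 where "H1 x = f x / (1 - F x)" for x
  define H2 where "H2 x = f' x / (1 - F x) + (f x)\<^sup>2 / (1 - F x)\<^sup>2" for x
  have "C2_diffeo H H1 H2"
  proof (rule C2_diffeoI)
    show "H r = 0" if "r \<le> 0" for r using F0[OF that] by (simp add: H_def)
    fix r :: real assume r: "0 < r"
    note Fr = Fpos[OF r] Flt[OF r]
    have d: "((\<lambda>x. 1 - F x) has_real_derivative - f r) (at r)"
      using DERIV_diff[OF DERIV_const Fd[OF r]] by simp
    show "0 < H r" using Fr by (simp add: H_def)
    show "0 < H1 r" using Fr fpos[OF r] by (simp add: H1_def)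
    show "(H has_real_derivative H1 r) (at r)"
      using DERIV_minus[OF DERIV_chain2[OF DERIV_ln_divide d]] Fr
      by (simp add: H_def[abs_def] H1_def)
    show "(H1 has_real_derivative H2 r) (at r)"
      using DERIV_divide[OF f'(1)[OF r] d] Fr
      by (simp add: H1_def[abs_def] H2_def add_divide_distrib power2_eq_square)
  next
    have "continuous_on {0<..} F"
      using DERIV_isCont[OF Fd] by (simp add: continuous_at_imp_continuous_on)
    moreover have "\<forall>x\<in>{0<..}. 1 - F x \<noteq> 0" using Flt by fastforce
    ultimately show "continuous_on {0<..} H2"
      unfolding H2_def[abs_def] by (intro continuous_intros fcont f'(2)) auto
  next
    fix s :: real assume s: "0 < s"
    \<comment> \<open>\<open>H r \<le> s\<close> amounts to \<open>F r \<le> 1 - exp (- s)\<close>,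
      so small and large values of \<open>H\<close> come from the limits 0 and 1 of
      \<open>F\<close>.\<close>
    have es: "0 < 1 - exp (- s)" "1 - exp (- s) < 1" using s by auto
    have "(F \<longlongrightarrow> 0) (at_right 0)"
      using N.cdf_is_right_cont[of 0] F0[of 0] by (simp add: continuous_within F_def)
    from order_tendstoD(2)[OF this es(1)]
    obtain b where b: "0 < b" "\<And>y. 0 < y \<Longrightarrow> y < b \<Longrightarrow> F y < 1 - exp (- s)"
      by (auto simp: eventually_at_right_field)
    have "F (b / 2) < 1 - exp (- s)" using b by simp
    then have "ln (exp (- s)) \<le> ln (1 - F (b / 2))"
      by (intro ln_mono) (use exp_gt_zero[of "- s"] in linarith)+
    then have "H (b / 2) \<le> s" by (simp add: H_def)
    with b show "\<exists>r>0. H r \<le> s" by (intro exI[of _ "b / 2"]) simp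
    have "(F \<longlongrightarrow> 1) at_top" using N.cdf_lim_at_top_prob by (simp add: F_def)
    from eventually_conj[OF order_tendstoD(1)[OF this es(2)] eventually_gt_at_top[of 0]]
    obtain r where r: "1 - exp (- s) < F r" "0 < r"
      by (auto simp: eventually_at_top_linorder)
    then have "ln (1 - F r) \<le> ln (exp (- s))"
      using Flt[OF r(2)] by (intro ln_mono) auto
    then have "s \<le> H r" by (simp add: H_def)
    with r show "\<exists>r>0. s \<le> H r" by blast
  qed
  moreover have "exp (- H x) * H1 x = f x" if "0 < x" for x
    using Flt[OF that] by (simp add: H_def H1_def)
  ultimately show thesis using that by blast
qed

subsection \<open>Mixtures of three curves\<close>

text \<open>The first coordinate is the parameter along a curve, the second a label 0, 1 or 2 that
  says which curve is used. Real labels put the sample space inside the plane.\<close>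

definition select :: "(real \<Rightarrow> 'b) \<Rightarrow> (real \<Rightarrow> 'b) \<Rightarrow> (real \<Rightarrow> 'b) \<Rightarrow> real \<times> real \<Rightarrow> 'b" where
  "select a b c \<omega> =
     (if snd \<omega> = 0 then a (fst \<omega>) else if snd \<omega> = 1 then b (fst \<omega>) else c (fst \<omega>))"

definition mixture ::
  "(real \<Rightarrow> real) \<Rightarrow> (real \<Rightarrow> real) \<Rightarrow> (real \<Rightarrow> real) \<Rightarrow> (real \<times> real) measure" where
  "mixture k0 k1 k2 =
     density (lborel \<Otimes>\<^sub>M count_space {0, 1, 2})
       (\<lambda>\<omega>. ennreal (select k0 k1 k2 \<omega>) * indicator {0<..} (fst \<omega>))"

lemma measurable_select [measurable]:
  assumes [measurable]: "a \<in> measurable borel N" "b \<in> measurable borel N" "c \<in> measurable borel N"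
  shows "select a b c \<in> measurable (lborel \<Otimes>\<^sub>M count_space {0, 1, 2}) N"
  unfolding select_def[abs_def] by measurable

lemma select_measurable_mixture:
  assumes "a \<in> measurable borel N" "b \<in> measurable borel N" "c \<in> measurable borel N"
  shows "select a b c \<in> measurable (mixture k0 k1 k2) N"
  using measurable_select[OF assms] by (simp add: mixture_def)

text \<open>Tonelli's theorem, with the integral over the labels written as a sum of three
  terms.\<close>

lemma emeasure_mixture_select:
  assumes [measurable]: "k0 \<in> borel_measurable borel" "k1 \<in> borel_measurable borel"
      "k2 \<in> borel_measurable borel"
    and [measurable]: "a \<in> measurable borel N" "b \<in> measurable borel N" "c \<in> measurable borel N"
    and [measurable]: "A \<in> sets N"
  shows "emeasure (distr (mixture k0 k1 k2) N (select a b c)) A =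
    (\<integral>\<^sup>+r. ennreal (k0 r) * indicator A (a r) * indicator {0<..} r \<partial>lborel) +
    (\<integral>\<^sup>+r. ennreal (k1 r) * indicator A (b r) * indicator {0<..} r \<partial>lborel) +
    (\<integral>\<^sup>+r. ennreal (k2 r) * indicator A (c r) * indicator {0<..} r \<partial>lborel)"
proof -
  let ?B = "lborel \<Otimes>\<^sub>M count_space {0, 1, 2 :: real}"
  interpret C: sigma_finite_measure "count_space {0, 1, 2 :: real}"
    by (rule sigma_finite_measure_count_space_finite) simp
  have count: "(\<integral>\<^sup>+t. g t \<partial>count_space {0, 1, 2}) = g 0 + g 1 + g 2" for g :: "real \<Rightarrow> ennreal"
    by (simp add: nn_integral_count_space_finite add.assoc)
  have S [measurable]: "select a b c \<in> measurable ?B N" by measurable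
  have [measurable]: "(\<lambda>\<omega>. indicator A (select a b c \<omega>) :: ennreal) \<in> borel_measurable ?B"
    by (rule measurable_compose[OF S]) measurable
  have M: "(\<lambda>\<omega>. ennreal (select k0 k1 k2 \<omega>) * indicator {0<..} (fst \<omega>) *
      indicator A (select a b c \<omega>)) \<in> borel_measurable ?B"
    by measurable
  have "emeasure (distr (mixture k0 k1 k2) N (select a b c)) A =
      emeasure (mixture k0 k1 k2) (select a b c -` A \<inter> space ?B)"
    by (subst emeasure_distr) (simp_all add: mixture_def)
  also have "\<dots> = (\<integral>\<^sup>+\<omega>. ennreal (select k0 k1 k2 \<omega>) * indicator {0<..} (fst \<omega>) *
      indicator (select a b c -` A \<inter> space ?B) \<omega> \<partial>?B)"
    unfolding mixture_def by (rule emeasure_density) measurable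
  also have "\<dots> = (\<integral>\<^sup>+\<omega>. ennreal (select k0 k1 k2 \<omega>) * indicator {0<..} (fst \<omega>) *
      indicator A (select a b c \<omega>) \<partial>?B)"
    by (rule nn_integral_cong) (auto split: split_indicator)
  also have "\<dots> = (\<integral>\<^sup>+r. (\<integral>\<^sup>+t. ennreal (select k0 k1 k2 (r, t)) * indicator {0<..} r *
      indicator A (select a b c (r, t)) \<partial>count_space {0, 1, 2}) \<partial>lborel)"
    using C.nn_integral_fst[OF M] by simp
  also have "\<dots> = (\<integral>\<^sup>+r. ennreal (k0 r) * indicator A (a r) * indicator {0<..} r +
      ennreal (k1 r) * indicator A (b r) * indicator {0<..} r +
      ennreal (k2 r) * indicator A (c r) * indicator {0<..} r \<partial>lborel)"
    by (rule nn_integral_cong) (simp add: count select_def mult.assoc mult.commute[of "indicator {0<..} _"])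
  finally show ?thesis
    by (simp add: nn_integral_add)
qed

text \<open>Translating the third curve by \<open>d\<close> puts all mass at the common argument
  \<open>X r\<close>, where the weights add up to the exponential density. Substituting
  \<open>r = H s\<close> turns this into \<open>exp (- H s) * H1 s = f s\<close>.\<close>

lemma shifted_mixture_marginal:
  fixes k0 k1 k2 :: "real \<Rightarrow> real"
  assumes X: "C2_diffeo X X1 X2" and H: "C2_diffeo H H1 H2"
    and inv: "\<And>s. 0 < s \<Longrightarrow> X (H s) = s"
    and f: "\<And>s. 0 < s \<Longrightarrow> exp (- H s) * H1 s = f s" "\<And>s. s \<le> 0 \<Longrightarrow> f s = 0"
    and [measurable]: "k0 \<in> borel_measurable borel" "k1 \<in> borel_measurable borel"
      "k2 \<in> borel_measurable borel" "A \<in> sets borel"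
    and k: "\<And>r. 0 \<le> k0 r" "\<And>r. 0 \<le> k1 r" "\<And>r. 0 \<le> k2 r" "\<And>r. r \<le> 0 \<Longrightarrow> k2 r = 0"
    and sum: "\<And>r. 0 < r \<Longrightarrow> k0 r + k1 r + k2 (r - d) = exp (- r)" and d: "0 \<le> d"
  shows "(\<integral>\<^sup>+r. ennreal (k0 r) * indicator A (X r) * indicator {0<..} r \<partial>lborel) +
    (\<integral>\<^sup>+r. ennreal (k1 r) * indicator A (X r) * indicator {0<..} r \<partial>lborel) +
    (\<integral>\<^sup>+r. ennreal (k2 r) * indicator A (X (r + d)) * indicator {0<..} r \<partial>lborel) =
    (\<integral>\<^sup>+s. ennreal (f s) * indicator A s \<partial>lborel)"
proof -
  note [measurable] = C2_diffeo_measurable[OF X] C2_diffeo_measurable[OF H]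
  \<comment> \<open>Since \<open>k2\<close> vanishes on nonpositive arguments, nothing is lost
    between 0 and \<open>d\<close>, and the translation maps one half-line onto the other.\<close>
  have "(\<integral>\<^sup>+r. ennreal (k2 (r - d)) * indicator A (X r) * indicator {0<..} r \<partial>lborel) =
      (\<integral>\<^sup>+r. ennreal (k2 (r - d)) * indicator A (X r) * indicator {d<..} r \<partial>lborel)"
    by (rule nn_integral_cong) (use k(4) d in \<open>auto split: split_indicator\<close>)
  also have "\<dots> = (\<integral>\<^sup>+r. ennreal (k2 r) * indicator A (X (r + d)) * indicator {0<..} r \<partial>lborel)"
    by (subst nn_integral_real_affine[where c = 1 and t = d])
      (auto simp: add.commute intro!: nn_integral_cong split: split_indicator)
  finally have shift: "(\<integral>\<^sup>+r. ennreal (k2 r) * indicator A (X (r + d)) * indicator {0<..} r \<partial>lborel) =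
    (\<integral>\<^sup>+r. ennreal (k2 (r - d)) * indicator A (X r) * indicator {0<..} r \<partial>lborel)" by simp
  have "(\<integral>\<^sup>+r. ennreal (k0 r) * indicator A (X r) * indicator {0<..} r \<partial>lborel) +
    (\<integral>\<^sup>+r. ennreal (k1 r) * indicator A (X r) * indicator {0<..} r \<partial>lborel) +
    (\<integral>\<^sup>+r. ennreal (k2 (r - d)) * indicator A (X r) * indicator {0<..} r \<partial>lborel) =
    (\<integral>\<^sup>+r. ennreal (k0 r) * indicator A (X r) * indicator {0<..} r +
      ennreal (k1 r) * indicator A (X r) * indicator {0<..} r +
      ennreal (k2 (r - d)) * indicator A (X r) * indicator {0<..} r \<partial>lborel)"
    by (simp add: nn_integral_add)
  also have "\<dots> = (\<integral>\<^sup>+r. ennreal (exp (- r)) * indicator A (X r) * indicator {0<..} r \<partial>lborel)"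
    by (rule nn_integral_cong) (use k in \<open>simp add: sum[symmetric] split: split_indicator\<close>)
  also have "\<dots> = (\<integral>\<^sup>+s. ennreal (exp (- H s)) * indicator A (X (H s)) * ennreal (H1 s) *
      indicator {0<..} s \<partial>lborel)"
    by (rule nn_integral_C2_diffeo[OF H]) measurable
  also have "\<dots> = (\<integral>\<^sup>+s. ennreal (f s) * indicator A s \<partial>lborel)"
  proof (rule nn_integral_cong)
    fix s :: real
    show "ennreal (exp (- H s)) * indicator A (X (H s)) * ennreal (H1 s) * indicator {0<..} s =
      ennreal (f s) * indicator A s"
      using inv[of s] f[of s] C2_diffeoD(4)[OF H, of s]
      by (cases "0 < s") (auto simp: ennreal_mult'[symmetric] split: split_indicator)
  qed
  finally show ?thesis using shift by simp
qed

lemma C2_diffeo_image_density: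
  assumes D: "C2_diffeo \<Phi> \<Phi>1 \<Phi>2" and I: "C2_diffeo \<Psi> \<Psi>1 \<Psi>2"
    and inv: "\<And>s. 0 < s \<Longrightarrow> \<Phi> (\<Psi> s) = s"
    and [measurable]: "k \<in> borel_measurable borel" "A \<in> sets borel" and k: "\<And>r. 0 \<le> k r"
  shows "(\<integral>\<^sup>+r. ennreal (k r) * indicator A (\<Phi> r) * indicator {0<..} r \<partial>lborel) =
    (\<integral>\<^sup>+s. ennreal (k (\<Psi> s) * \<Psi>1 s) * indicator A s * indicator {0<..} s \<partial>lborel)"
proof -
  note [measurable] = C2_diffeo_measurable[OF D]
  have "(\<integral>\<^sup>+r. ennreal (k r) * indicator A (\<Phi> r) * indicator {0<..} r \<partial>lborel) =
    (\<integral>\<^sup>+s. ennreal (k (\<Psi> s)) * indicator A (\<Phi> (\<Psi> s)) * ennreal (\<Psi>1 s) * indicator {0<..} s \<partial>lborel)"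
    by (rule nn_integral_C2_diffeo[OF I]) measurable
  also have "\<dots> = (\<integral>\<^sup>+s. ennreal (k (\<Psi> s) * \<Psi>1 s) * indicator A s * indicator {0<..} s \<partial>lborel)"
    by (rule nn_integral_cong)
      (use inv k C2_diffeoD(4)[OF I] in \<open>auto simp: ennreal_mult' split: split_indicator\<close>)
  finally show ?thesis .
qed

text \<open>The transported density contains the factor \<open>\<Psi>1\<close>, so its derivative
  involves \<open>\<Psi>2\<close>: this is where the second derivative of the diffeomorphism
  enters.\<close>

lemma C2_diffeo_image_density_deriv:
  assumes I: "C2_diffeo \<Psi> \<Psi>1 \<Psi>2"
    and k: "\<And>r. (k has_real_derivative k' r) (at r)" "continuous_on UNIV k'"
  shows "\<And>s. 0 < s \<Longrightarrow> ((\<lambda>s. k (\<Psi> s) * \<Psi>1 s) has_real_derivative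
      k' (\<Psi> s) * (\<Psi>1 s)\<^sup>2 + k (\<Psi> s) * \<Psi>2 s) (at s)"
    and "continuous_on {0<..} (\<lambda>s. k' (\<Psi> s) * (\<Psi>1 s)\<^sup>2 + k (\<Psi> s) * \<Psi>2 s)"
proof -
  note ID = C2_diffeoD[OF I]
  show "((\<lambda>s. k (\<Psi> s) * \<Psi>1 s) has_real_derivative
      k' (\<Psi> s) * (\<Psi>1 s)\<^sup>2 + k (\<Psi> s) * \<Psi>2 s) (at s)" if s: "0 < s" for s
    using DERIV_mult[OF DERIV_chain2[OF k(1) ID(3)[OF s]] ID(5)[OF s]]
    by (simp add: power2_eq_square algebra_simps)
  have "continuous_on UNIV k"
    using DERIV_isCont[OF k(1)] by (simp add: continuous_at_imp_continuous_on)
  then have "continuous_on {0<..} (\<lambda>s. k (\<Psi> s))" "continuous_on {0<..} (\<lambda>s. k' (\<Psi> s))"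
    using continuous_on_compose2[OF _ C2_diffeo_continuous(1)[OF I]] k(2) by blast+
  then show "continuous_on {0<..} (\<lambda>s. k' (\<Psi> s) * (\<Psi>1 s)\<^sup>2 + k (\<Psi> s) * \<Psi>2 s)"
    by (intro continuous_on_add continuous_on_mult continuous_on_power ID(6) C2_diffeo_continuous[OF I])
qed

text \<open>\<open>K\<close> is injective on the positive reals, with left inverse \<open>Y\<close>,
  so each section with fixed first coordinate has at most three points; Tonelli's theorem does the
  rest.\<close>

lemma null_set_three_shifts:
  fixes H K Y :: "real \<Rightarrow> real" and d :: real
  assumes [measurable]: "H \<in> borel_measurable borel" "K \<in> borel_measurable borel"
    and inv: "\<And>y. 0 < y \<Longrightarrow> Y (K y) = y"
  defines "A \<equiv> {p :: real \<times> real. 0 < snd p \<and>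
    (K (snd p) = H (fst p) \<or> K (snd p) = H (fst p) + d \<or> K (snd p) + d = H (fst p))}"
  shows "A \<in> sets borel" "emeasure lborel A = 0"
proof -
  have "{p \<in> space (borel \<Otimes>\<^sub>M borel). 0 < snd p \<and>
      (K (snd p) = H (fst p) \<or> K (snd p) = H (fst p) + d \<or> K (snd p) + d = H (fst p))}
      \<in> sets (borel \<Otimes>\<^sub>M borel)"
    by measurable
  then have "A \<in> sets (borel \<Otimes>\<^sub>M borel)" by (simp add: A_def space_pair_measure)
  then show A: "A \<in> sets borel" unfolding borel_prod .
  have "emeasure lborel A = emeasure (lborel \<Otimes>\<^sub>M lborel) A" by (simp add: lborel_prod)
  also have "\<dots> = (\<integral>\<^sup>+x. emeasure lborel (Pair x -` A) \<partial>lborel)"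
    by (rule lborel.emeasure_pair_measure_alt) (unfold lborel_prod, use A in simp)
  also have "\<dots> = (\<integral>\<^sup>+x. 0 \<partial>(lborel :: real measure))"
  proof (rule nn_integral_cong)
    fix x :: real
    have "Pair x -` A \<subseteq> Y ` {H x, H x + d, H x - d}"
    proof
      fix y assume "y \<in> Pair x -` A"
      then have "0 < y" "K y \<in> {H x, H x + d, H x - d}" by (auto simp: A_def)
      then show "y \<in> Y ` {H x, H x + d, H x - d}" using inv[of y] by (intro image_eqI[of y Y "K y"]) simp_all
    qed
    then have "finite (Pair x -` A)" by (rule finite_subset) simp
    then show "emeasure lborel (Pair x -` A) = 0" by (rule emeasure_lborel_countable[OF countable_finite])
  qed
  finally show "emeasure lborel A = 0" by simp
qed

subsection \<open>The oscillating coupling\<close>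

theorem theorem1p1:
  fixes f1 f2 :: "real \<Rightarrow> real"
  assumes "positive_density f1" and "positive_density f2"
    and "lin_condition 0 f1" and "lin_condition 0 f2"
  shows "\<exists>(M :: (real \<times> real) measure) (\<xi>1 :: real \<times> real \<Rightarrow> real) (\<xi>2 :: real \<times> real \<Rightarrow> real).
    prob_space M \<and>
    \<xi>1 \<in> borel_measurable M \<and> \<xi>2 \<in> borel_measurable M \<and>
    lebesgue_singular (distr M borel (\<lambda>\<omega>. (\<xi>1 \<omega>, \<xi>2 \<omega>))) \<and>
    distributed M lborel \<xi>1 (\<lambda>x. ennreal (f1 x)) \<and>
    distributed M lborel \<xi>2 (\<lambda>x. ennreal (f2 x)) \<and>
    (\<exists>g :: real \<Rightarrow> real.
      positive_density g \<and>
      distributed M lborel (\<lambda>\<omega>. \<xi>1 \<omega> * \<xi>2 \<omega>) (\<lambda>x. ennreal (g x)) \<and>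
      Limsup at_top (\<lambda>x. ereal (lin_fun g x)) = \<infinity> \<and>
      Liminf at_top (\<lambda>x. ereal (lin_fun g x)) = - \<infinity>)"
proof -

  \<comment> \<open>Hazards, their inverses, and the product along the three curves\<close>
  obtain H H1 H2 where H: "C2_diffeo H H1 H2" "\<And>x. 0 < x \<Longrightarrow> exp (- H x) * H1 x = f1 x"
    using C2_diffeo_hazard[OF assms(1)] by blast
  obtain K K1 K2 where K: "C2_diffeo K K1 K2" "\<And>x. 0 < x \<Longrightarrow> exp (- K x) * K1 x = f2 x"
    using C2_diffeo_hazard[OF assms(2)] by blast
  obtain X X1 X2 where X: "C2_diffeo X X1 X2" "\<And>r. 0 < r \<Longrightarrow> H (X r) = r" "\<And>s. 0 < s \<Longrightarrow> X (H s) = s"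
    using C2_diffeo_inverse[OF H(1)] by (metis (no_types, lifting))
  obtain Y Y1 Y2 where Y: "C2_diffeo Y Y1 Y2" "\<And>r. 0 < r \<Longrightarrow> K (Y r) = r" "\<And>s. 0 < s \<Longrightarrow> Y (K s) = s"
    using C2_diffeo_inverse[OF K(1)] by (metis (no_types, lifting))
  note [measurable] = C2_diffeo_measurable[OF H(1)] C2_diffeo_measurable[OF K(1)]
    C2_diffeo_measurable[OF X(1)] C2_diffeo_measurable[OF Y(1)]
  define D0 where "D0 r = X r * Y r" for r
  define D1 where "D1 r = X r * Y (r + 1/2)" for r
  define D2 where "D2 r = X (r + 1/2) * Y r" for r
  obtain D0' D0'' where D0: "C2_diffeo D0 D0' D0''"
    using C2_diffeo_mult_shift[OF X(1) Y(1), of 0] unfolding D0_def[abs_def] by auto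
  obtain D1' D1'' where D1: "C2_diffeo D1 D1' D1''"
    using C2_diffeo_mult_shift[OF X(1) Y(1), of "1/2"] unfolding D1_def[abs_def] by auto
  \<comment> \<open>The third curve is the second with the roles of \<open>X\<close> and
    \<open>Y\<close> exchanged.\<close>
  obtain D2' D2'' where D2: "C2_diffeo D2 D2' D2''"
    using C2_diffeo_mult_shift[OF Y(1) X(1), of "1/2"] unfolding D2_def[abs_def]
    by (auto simp: mult.commute)
  \<comment> \<open>Each \<open>E\<close> recovers the curve parameter from the value of the
    product; the matching \<open>p\<close> and \<open>q\<close> are its first two
    derivatives.\<close>
  obtain E0 p0 q0 where E0: "C2_diffeo E0 p0 q0" "\<And>r. 0 < r \<Longrightarrow> E0 (D0 r) = r" "\<And>s. 0 < s \<Longrightarrow> D0 (E0 s) = s"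
    using C2_diffeo_inverse[OF D0] by (metis (no_types, lifting))
  obtain E1 p1 q1 where E1: "C2_diffeo E1 p1 q1" "\<And>s. 0 < s \<Longrightarrow> D1 (E1 s) = s"
    using C2_diffeo_inverse[OF D1] by (metis (no_types, lifting))
  obtain E2 p2 q2 where E2: "C2_diffeo E2 p2 q2" "\<And>s. 0 < s \<Longrightarrow> D2 (E2 s) = s"
    using C2_diffeo_inverse[OF D2] by (metis (no_types, lifting))
  have Xmono: "X a < X b" and Ymono: "Y a < Y b" if "0 \<le> a" "a < b" for a b
    using C2_diffeo_strict_mono[OF X(1) that] C2_diffeo_strict_mono[OF Y(1) that] by auto
  note Xpos = C2_diffeoD(2)[OF X(1)] and Ypos = C2_diffeoD(2)[OF Y(1)]
  have D0pos: "0 < D0 r" if "0 < r" for r using C2_diffeoD(2)[OF D0 that] .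

  \<comment> \<open>Location of the off-diagonal preimages\<close>
  have E1_between: "r - 1/2 < E1 (D0 r) \<and> E1 (D0 r) < r" if "1 \<le> r" for r
  proof -
    have r: "0 < r" using that by simp
    define b where "b = E1 (D0 r)"
    have b: "0 < b" "D1 b = D0 r"
      using C2_diffeoD(2)[OF E1(1) D0pos[OF r]] E1(2)[OF D0pos[OF r]] by (simp_all add: b_def)
    \<comment> \<open>Each comparison changes one factor only: \<open>D1 r\<close> has the larger
      second factor, and \<open>D1 (r - 1/2)\<close> equals
      \<open>X (r - 1/2) * Y r\<close>.\<close>
    have "D0 r < D1 r"
      unfolding D0_def D1_def using Ymono[of r "r + 1/2"] Xpos[OF r] r by simp
    moreover have "D1 (r - 1/2) < D0 r"
      unfolding D0_def D1_def using Xmono[of "r - 1/2" r] Ypos[OF r] that by simp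
    moreover have "D1 r \<le> D1 b" if "r \<le> b" using monoD[OF C2_diffeo_mono[OF D1] that] .
    moreover have "D1 b \<le> D1 (r - 1/2)" if "b \<le> r - 1/2" using monoD[OF C2_diffeo_mono[OF D1] that] .
    ultimately show ?thesis using b unfolding b_def by linarith
  qed
  have E2_between: "r - 1/2 < E2 (D0 r) \<and> E2 (D0 r) < r" if "1 \<le> r" for r
  proof -
    have r: "0 < r" using that by simp
    define b where "b = E2 (D0 r)"
    have b: "0 < b" "D2 b = D0 r"
      using C2_diffeoD(2)[OF E2(1) D0pos[OF r]] E2(2)[OF D0pos[OF r]] by (simp_all add: b_def)
    have "D0 r < D2 r"
      unfolding D0_def D2_def using Xmono[of r "r + 1/2"] Ypos[OF r] r by simp
    moreover have "D2 (r - 1/2) < D0 r"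
      unfolding D0_def D2_def using Ymono[of "r - 1/2" r] Xpos[OF r] that by simp
    moreover have "D2 r \<le> D2 b" if "r \<le> b" using monoD[OF C2_diffeo_mono[OF D2] that] .
    moreover have "D2 b \<le> D2 (r - 1/2)" if "b \<le> r - 1/2" using monoD[OF C2_diffeo_mono[OF D2] that] .
    ultimately show ?thesis using b unfolding b_def by linarith
  qed

  \<comment> \<open>Choice of the slopes\<close>
  define \<alpha> where "\<alpha> n = D0 (of_int n) * p0 (D0 (of_int n)) / 15" for n :: int
  \<comment> \<open>These are the coefficients of Lin's function of the product density at
    \<open>D0 n\<close>, as an affine function of \<open>m n\<close>. The 15 comes from the diagonal
    weight 1 - 1/16 at \<open>n\<close>.\<close>
  define \<beta> where "\<beta> n = D0 (of_int n) * p0 (D0 (of_int n)) -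
    D0 (of_int n) * q0 (D0 (of_int n)) / p0 (D0 (of_int n))" for n :: int
  define e1 where "e1 n = of_int n - E1 (D0 (of_int n))" for n :: int
  define e2 where "e2 n = of_int n - E2 (D0 (of_int n))" for n :: int
  have \<alpha>: "0 < \<alpha> n" if "1 \<le> n" for n
    using that D0pos[of "of_int n"] C2_diffeoD(4)[OF E0(1), of "D0 (of_int n)"] by (simp add: \<alpha>_def)
  have e: "0 < e1 n" "e1 n < 1/2" "0 < e2 n" "e2 n < 1/2" if "1 \<le> n" for n
    using that E1_between[of "of_int n"] E2_between[of "of_int n"] by (auto simp: e1_def e2_def)
  \<comment> \<open>The sum meets all demands at once: 4 for the bump train, the reciprocals so that
    the bump at \<open>n\<close> misses both off-diagonal preimages, and the quotient so that
    \<open>\<alpha> n * c n\<close> beats \<open>\<beta> n\<close> by at least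
    \<open>n\<close>.\<close>
  define c where "c n = 4 + 1 / e1 n + 1 / e2 n + (of_int n + \<bar>\<beta> n\<bar>) / \<alpha> n" for n :: int
  \<comment> \<open>The sign alternates with parity. The value 4 for \<open>n < 1\<close> is a
    default respecting the bound on slopes; the bumps start at \<open>n = 1\<close>.\<close>
  define m where "m n = (if n < 1 then 4 else if even n then c n else - c n)" for n :: int
  have c: "4 \<le> c n" "1 / c n \<le> e1 n" "1 / c n \<le> e2 n" "of_int n + \<bar>\<beta> n\<bar> \<le> \<alpha> n * c n"
    if n: "1 \<le> n" for n
  proof -
    have *: "0 < 1 / e1 n" "0 < 1 / e2 n" "0 \<le> (of_int n + \<bar>\<beta> n\<bar>) / \<alpha> n"
      using e[OF n] \<alpha>[OF n] n by simp_all
    then show c4: "4 \<le> c n" by (simp add: c_def)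
    have "1 / e1 n \<le> c n" "1 / e2 n \<le> c n" using * by (simp_all add: c_def)
    then show "1 / c n \<le> e1 n" "1 / c n \<le> e2 n"
      using e[OF n] c4 by (simp_all add: field_simps)
    have "(of_int n + \<bar>\<beta> n\<bar>) / \<alpha> n \<le> c n" using * by (simp add: c_def)
    then show "of_int n + \<bar>\<beta> n\<bar> \<le> \<alpha> n * c n" using \<alpha>[OF n] by (simp add: field_simps)
  qed
  have m4: "4 \<le> \<bar>m n\<bar>" for n using c(1)[of n] by (auto simp: m_def)
  have mabs: "\<bar>m n\<bar> = c n" if "1 \<le> n" for n using c(1)[OF that] that by (auto simp: m_def)

  \<comment> \<open>Weights of the three curves\<close>
  obtain w w' :: "real \<Rightarrow> real" where
    w': "\<And>r. (w has_real_derivative w' r) (at r)" "continuous_on UNIV w'"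
    and w: "\<And>r. 0 \<le> w r" "\<And>r. w r \<le> 1 / 8" "\<And>r. r \<le> 0 \<Longrightarrow> w r = 0"
    and wn: "\<And>n. 1 \<le> n \<Longrightarrow> w (of_int n) = 1 / 16" "\<And>n. 1 \<le> n \<Longrightarrow> w' (of_int n) = m n / 16"
    and wz: "\<And>n r. 1 / \<bar>m n\<bar> \<le> \<bar>r - of_int n\<bar> \<Longrightarrow> \<bar>r - of_int n\<bar> \<le> 1 / 2 \<Longrightarrow> w r = 0 \<and> w' r = 0"
    by (rule exists_bump_train[OF m4]) (rule that)
  have wcont: "continuous_on UNIV w"
    using DERIV_isCont[OF w'(1)] by (simp add: continuous_at_imp_continuous_on)
  \<comment> \<open>Shifting \<open>exp (- r)\<close> by 1/2 costs this factor, so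
    \<open>k1 (r - 1/2)\<close> equals \<open>exp (- r) * \<rho> * w (r - 1/2)\<close>. The bound by
    2 follows from \<open>exp 1 \<le> 3\<close>.\<close>
  define \<rho> :: real where "\<rho> = exp (1/2)"
  have \<rho>: "0 < \<rho>" "\<rho> \<le> 2"
  proof -
    show "0 < \<rho>" by (simp add: \<rho>_def)
    have "\<rho>\<^sup>2 = exp 1" by (simp add: \<rho>_def power2_eq_square flip: exp_add)
    also have "\<dots> \<le> 2\<^sup>2" using exp_le by simp
    finally show "\<rho> \<le> 2" by (rule power2_le_imp_le) simp
  qed
  define k0 where "k0 r = exp (- r) * (1 - w r - \<rho> * w (r - 1/2))" for r
  define k1 where "k1 r = exp (- r) * w r" for r
  define k0' where "k0' r = exp (- r) * (- w' r - \<rho> * w' (r - 1/2)) - k0 r" for r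
  define k1' where "k1' r = exp (- r) * w' r - k1 r" for r
  have \<rho>w: "\<rho> * w r \<le> 1/4" for r
    using mult_mono[OF \<rho>(2) w(2)[of r]] \<rho>(1) w(1)[of r] by simp
  have k0pos: "0 < k0 r" for r
  proof -
    \<comment> \<open>The mass removed from the diagonal has relative density at most 1/8 +
      1/4.\<close>
    have "0 < 1 - w r - \<rho> * w (r - 1/2)" using w(2)[of r] \<rho>w[of "r - 1/2"] by linarith
    then show ?thesis by (simp add: k0_def)
  qed
  have k1nn: "0 \<le> k1 r" for r using w(1) by (simp add: k1_def)
  have k1z: "k1 r = 0" if "r \<le> 0" for r using w(3)[OF that] by (simp add: k1_def)
  \<comment> \<open>Each marginal sees the diagonal, one off-diagonal curve in place, and the other
    shifted by 1/2; this balance preserves the exponential law of the parameter.\<close>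
  have ksum: "k0 r + k1 r + k1 (r - 1/2) = exp (- r)" for r
    by (simp add: k0_def k1_def \<rho>_def algebra_simps flip: exp_add)
  have wsh: "((\<lambda>r. w (r - 1/2)) has_real_derivative w' (r - 1/2)) (at r)" for r
  proof -
    have "((\<lambda>r. r - 1/2) has_real_derivative 1) (at r)" by (auto intro!: derivative_eq_intros)
    from DERIV_chain2[OF w'(1) this] show ?thesis by simp
  qed
  have dexp: "((\<lambda>r. exp (- r)) has_real_derivative - exp (- r)) (at r)" for r :: real
    by (auto intro!: derivative_eq_intros)
  have k1d: "(k1 has_real_derivative k1' r) (at r)" for r
    using DERIV_mult[OF dexp[of r] w'(1)[of r]] unfolding k1_def[abs_def] k1'_def
    by (simp add: algebra_simps)
  have k0d: "(k0 has_real_derivative k0' r) (at r)" for r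
  proof -
    have "((\<lambda>r. 1 - w r - \<rho> * w (r - 1/2)) has_real_derivative 0 - w' r - \<rho> * w' (r - 1/2)) (at r)"
      by (intro DERIV_diff DERIV_const w'(1) DERIV_cmult wsh)
    from DERIV_mult[OF dexp this] show ?thesis
      unfolding k0_def[abs_def] k0'_def by (simp add: algebra_simps)
  qed
  have k0cont: "continuous_on UNIV k0" and k1cont: "continuous_on UNIV k1"
    using DERIV_isCont[OF k0d] DERIV_isCont[OF k1d] by (simp_all add: continuous_at_imp_continuous_on)
  have k1c: "continuous_on UNIV k1'"
    unfolding k1'_def[abs_def] by (intro continuous_intros w'(2) k1cont)
  have k0c: "continuous_on UNIV k0'"
    unfolding k0'_def[abs_def]
    by (intro continuous_intros w'(2) k0cont continuous_on_compose2[OF w'(2)]) auto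
  have [measurable]: "k0 \<in> borel_measurable borel" "k1 \<in> borel_measurable borel"
    using k0cont k1cont by (simp_all add: borel_measurable_continuous_onI)

  \<comment> \<open>The random vector\<close>
  define M where "M = mixture k0 k1 k1"
  define \<xi>1 where "\<xi>1 = select X X (\<lambda>r. X (r + 1/2))"
  define \<xi>2 where "\<xi>2 = select Y (\<lambda>r. Y (r + 1/2)) Y"
  have \<xi>m: "\<xi>1 \<in> borel_measurable M" "\<xi>2 \<in> borel_measurable M"
    unfolding M_def \<xi>1_def \<xi>2_def by (intro select_measurable_mixture; measurable)+
  have pair: "(\<lambda>\<omega>. (\<xi>1 \<omega>, \<xi>2 \<omega>)) =
    select (\<lambda>r. (X r, Y r)) (\<lambda>r. (X r, Y (r + 1/2))) (\<lambda>r. (X (r + 1/2), Y r))"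
    by (simp add: fun_eq_iff select_def \<xi>1_def \<xi>2_def)
  have prod: "(\<lambda>\<omega>. \<xi>1 \<omega> * \<xi>2 \<omega>) = select D0 D1 D2"
    by (simp add: fun_eq_iff select_def \<xi>1_def \<xi>2_def D0_def D1_def D2_def)
  have [measurable]: "f1 \<in> borel_measurable borel" "f2 \<in> borel_measurable borel"
    and f_zero: "\<And>s. s \<le> 0 \<Longrightarrow> f1 s = 0" "\<And>s. s \<le> 0 \<Longrightarrow> f2 s = 0"
    and f_int: "(\<integral>\<^sup>+ x. ennreal (f1 x) \<partial>lborel) = 1"
    using assms(1,2) by (auto simp: positive_density_def)

  \<comment> \<open>Marginal distributions\<close>
  have d1: "distr M lborel \<xi>1 = density lborel (\<lambda>x. ennreal (f1 x))"
  proof (rule measure_eqI)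
    fix A assume "A \<in> sets (distr M lborel \<xi>1)"
    then have [measurable]: "A \<in> sets borel" by simp
    have "emeasure (distr M lborel \<xi>1) A = (\<integral>\<^sup>+s. ennreal (f1 s) * indicator A s \<partial>lborel)"
      unfolding M_def \<xi>1_def
      by (subst emeasure_mixture_select; (simp; fail)?)
        (rule shifted_mixture_marginal[OF X(1) H(1) X(3) H(2) f_zero(1)],
         use k0pos k1nn k1z ksum in \<open>auto simp: less_imp_le\<close>)
    then show "emeasure (distr M lborel \<xi>1) A = emeasure (density lborel (\<lambda>x. ennreal (f1 x))) A"
      by (simp add: emeasure_density)
  qed simp
  have d2: "distr M lborel \<xi>2 = density lborel (\<lambda>x. ennreal (f2 x))"
  proof (rule measure_eqI)
    fix A assume "A \<in> sets (distr M lborel \<xi>2)"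
    then have [measurable]: "A \<in> sets borel" by simp
    have "emeasure (distr M lborel \<xi>2) A =
      (\<integral>\<^sup>+r. ennreal (k0 r) * indicator A (Y r) * indicator {0<..} r \<partial>lborel) +
      (\<integral>\<^sup>+r. ennreal (k1 r) * indicator A (Y (r + 1/2)) * indicator {0<..} r \<partial>lborel) +
      (\<integral>\<^sup>+r. ennreal (k1 r) * indicator A (Y r) * indicator {0<..} r \<partial>lborel)"
      unfolding M_def \<xi>2_def by (rule emeasure_mixture_select) simp_all
    \<comment> \<open>For the second coordinate the shift sits on curve 1 rather than curve 2, so
      the two off-diagonal terms are exchanged first.\<close>
    also have "\<dots> =
      (\<integral>\<^sup>+r. ennreal (k0 r) * indicator A (Y r) * indicator {0<..} r \<partial>lborel) +
      (\<integral>\<^sup>+r. ennreal (k1 r) * indicator A (Y r) * indicator {0<..} r \<partial>lborel) +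
      (\<integral>\<^sup>+r. ennreal (k1 r) * indicator A (Y (r + 1/2)) * indicator {0<..} r \<partial>lborel)"
      by (simp only: ac_simps)
    also have "\<dots> = (\<integral>\<^sup>+s. ennreal (f2 s) * indicator A s \<partial>lborel)"
      by (rule shifted_mixture_marginal[OF Y(1) K(1) Y(3) K(2) f_zero(2)])
        (use k0pos k1nn k1z ksum in \<open>auto simp: less_imp_le\<close>)
    finally show "emeasure (distr M lborel \<xi>2) A = emeasure (density lborel (\<lambda>x. ennreal (f2 x))) A"
      by (simp add: emeasure_density)
  qed simp
  have prob: "prob_space M"
  proof
    have "emeasure M (space M) = emeasure (distr M lborel \<xi>1) UNIV"
      using \<xi>m by (simp add: emeasure_distr)
    then show "emeasure M (space M) = 1"
      using f_int by (simp add: d1 emeasure_density)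
  qed

  \<comment> \<open>Singularity of the joint law\<close>
  have singular: "lebesgue_singular (distr M borel (\<lambda>\<omega>. (\<xi>1 \<omega>, \<xi>2 \<omega>)))"
  proof -
    define A where "A = {p :: real \<times> real. 0 < snd p \<and>
      (K (snd p) = H (fst p) \<or> K (snd p) = H (fst p) + 1/2 \<or> K (snd p) + 1/2 = H (fst p))}"
    have A [measurable]: "A \<in> sets borel" "emeasure lborel A = 0"
      unfolding A_def using null_set_three_shifts[of H K Y "1/2"] Y(3) by auto
    \<comment> \<open>\<open>H\<close> and \<open>K\<close> recover the parameters of the two
      coordinates, which differ by 0 or 1/2 on every curve.\<close>
    have in_A: "(X r, Y r) \<in> A" "(X r, Y (r + 1/2)) \<in> A" "(X (r + 1/2), Y r) \<in> A" if "0 < r" for r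
      using that X(2) Y(2) Ypos by (simp_all add: A_def)
    have "emeasure (distr M borel (\<lambda>\<omega>. (\<xi>1 \<omega>, \<xi>2 \<omega>))) (- A) = 0"
    proof -
      have z: "(\<integral>\<^sup>+r. ennreal (k r) * indicator (- A) (a r) * indicator {0<..} r \<partial>lborel) = 0"
        if "\<And>r. 0 < r \<Longrightarrow> a r \<in> A" for a :: "real \<Rightarrow> real \<times> real" and k
      proof -
        have "(\<integral>\<^sup>+r. ennreal (k r) * indicator (- A) (a r) * indicator {0<..} r \<partial>lborel) =
          (\<integral>\<^sup>+r. 0 \<partial>(lborel :: real measure))"
          by (rule nn_integral_cong) (use that in \<open>auto split: split_indicator\<close>)
        then show ?thesis by simp
      qed
      show ?thesis
        unfolding pair M_def by (subst emeasure_mixture_select) (simp_all add: z in_A)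
    qed
    then show ?thesis
      unfolding lebesgue_singular_def using A by (intro bexI[of _ A]) (auto simp: Compl_eq_Diff_UNIV)
  qed

  \<comment> \<open>Density of the product\<close>
  define g where "g s = (if 0 < s then k0 (E0 s) * p0 s + k1 (E1 s) * p1 s + k1 (E2 s) * p2 s else 0)" for s
  define g' where "g' s = (k0' (E0 s) * (p0 s)\<^sup>2 + k0 (E0 s) * q0 s) +
    (k1' (E1 s) * (p1 s)\<^sup>2 + k1 (E1 s) * q1 s) + (k1' (E2 s) * (p2 s)\<^sup>2 + k1 (E2 s) * q2 s)" for s
  note pp0 = C2_diffeoD(4)[OF E0(1)] and pp1 = C2_diffeoD(4)[OF E1(1)] and pp2 = C2_diffeoD(4)[OF E2(1)]
  \<comment> \<open>The diagonal term is strictly positive by itself; the other two are only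
    nonnegative.\<close>
  have gpos: "0 < g s" if "0 < s" for s
    using pp0[OF that] pp1[OF that] pp2[OF that] k0pos k1nn that
    by (simp add: g_def add_pos_nonneg)
  have gd: "(g has_real_derivative g' s) (at s)" if "0 < s" for s
  proof (rule has_field_derivative_transform_within_open)
    show "((\<lambda>s. k0 (E0 s) * p0 s + k1 (E1 s) * p1 s + k1 (E2 s) * p2 s) has_real_derivative g' s) (at s)"
      unfolding g'_def
      by (intro DERIV_add C2_diffeo_image_density_deriv(1)[OF E0(1) k0d k0c that]
          C2_diffeo_image_density_deriv(1)[OF E1(1) k1d k1c that]
          C2_diffeo_image_density_deriv(1)[OF E2(1) k1d k1c that])
    show "open {0 :: real<..}" "s \<in> {0<..}" using that by auto
  qed (simp add: g_def)
  have g'c: "continuous_on {0<..} g'"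
    unfolding g'_def[abs_def]
    by (intro continuous_on_add C2_diffeo_image_density_deriv(2)[OF E0(1) k0d k0c]
        C2_diffeo_image_density_deriv(2)[OF E1(1) k1d k1c]
        C2_diffeo_image_density_deriv(2)[OF E2(1) k1d k1c])
  have p_meas: "(\<lambda>s. indicator {0<..} s *\<^sub>R p s) \<in> borel_measurable borel"
    if "C2_diffeo E p q" for E p q
    by (intro borel_measurable_continuous_on_indicator C2_diffeo_continuous(2)[OF that]) simp
  note [measurable] = C2_diffeo_measurable[OF E0(1)] C2_diffeo_measurable[OF E1(1)]
    C2_diffeo_measurable[OF E2(1)] C2_diffeo_measurable[OF D0] C2_diffeo_measurable[OF D1]
    C2_diffeo_measurable[OF D2]
  \<comment> \<open>The terms are cut off to the half-line, where the derivatives of the inverse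
    maps are continuous, to obtain global measurability.\<close>
  define P0 where "P0 s = indicator {0<..} s *\<^sub>R (k0 (E0 s) * p0 s)" for s
  define P1 where "P1 s = indicator {0<..} s *\<^sub>R (k1 (E1 s) * p1 s)" for s
  define P2 where "P2 s = indicator {0<..} s *\<^sub>R (k1 (E2 s) * p2 s)" for s
  have [measurable]: "P0 \<in> borel_measurable borel" "P1 \<in> borel_measurable borel" "P2 \<in> borel_measurable borel"
    using borel_measurable_times[OF _ p_meas[OF E0(1)], of "\<lambda>s. k0 (E0 s)"]
      borel_measurable_times[OF _ p_meas[OF E1(1)], of "\<lambda>s. k1 (E1 s)"]
      borel_measurable_times[OF _ p_meas[OF E2(1)], of "\<lambda>s. k1 (E2 s)"]
    by (simp_all add: P0_def[abs_def] P1_def[abs_def] P2_def[abs_def] mult.left_commute)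
  have g_P: "g = (\<lambda>s. P0 s + P1 s + P2 s)"
    by (simp add: fun_eq_iff g_def P0_def P1_def P2_def)
  have Pnn: "0 \<le> P0 s" "0 \<le> P1 s" "0 \<le> P2 s" for s
    using pp0[of s] pp1[of s] pp2[of s] k0pos[of "E0 s"] k1nn
    by (auto simp: P0_def P1_def P2_def split: split_indicator)
  have gm [measurable]: "g \<in> borel_measurable borel" unfolding g_P by measurable
  have dg: "distr M lborel (\<lambda>\<omega>. \<xi>1 \<omega> * \<xi>2 \<omega>) = density lborel (\<lambda>x. ennreal (g x))"
  proof (rule measure_eqI)
    fix A assume "A \<in> sets (distr M lborel (\<lambda>\<omega>. \<xi>1 \<omega> * \<xi>2 \<omega>))"
    then have [measurable]: "A \<in> sets borel" by simp
    have "emeasure (distr M lborel (\<lambda>\<omega>. \<xi>1 \<omega> * \<xi>2 \<omega>)) A =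
      (\<integral>\<^sup>+r. ennreal (k0 r) * indicator A (D0 r) * indicator {0<..} r \<partial>lborel) +
      (\<integral>\<^sup>+r. ennreal (k1 r) * indicator A (D1 r) * indicator {0<..} r \<partial>lborel) +
      (\<integral>\<^sup>+r. ennreal (k1 r) * indicator A (D2 r) * indicator {0<..} r \<partial>lborel)"
      unfolding prod M_def by (rule emeasure_mixture_select) simp_all
    also have "\<dots> =
      (\<integral>\<^sup>+s. ennreal (k0 (E0 s) * p0 s) * indicator A s * indicator {0<..} s \<partial>lborel) +
      (\<integral>\<^sup>+s. ennreal (k1 (E1 s) * p1 s) * indicator A s * indicator {0<..} s \<partial>lborel) +
      (\<integral>\<^sup>+s. ennreal (k1 (E2 s) * p2 s) * indicator A s * indicator {0<..} s \<partial>lborel)"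
      by (intro arg_cong2[where f = "(+)"] C2_diffeo_image_density[OF D0 E0(1) E0(3)]
          C2_diffeo_image_density[OF D1 E1] C2_diffeo_image_density[OF D2 E2])
        (use k0pos k1nn in \<open>auto simp: less_imp_le\<close>)
    also have "\<dots> =
      (\<integral>\<^sup>+s. ennreal (P0 s) * indicator A s \<partial>lborel) +
      (\<integral>\<^sup>+s. ennreal (P1 s) * indicator A s \<partial>lborel) +
      (\<integral>\<^sup>+s. ennreal (P2 s) * indicator A s \<partial>lborel)"
      by (intro arg_cong2[where f = "(+)"] nn_integral_cong)
        (simp_all add: P0_def P1_def P2_def split: split_indicator)
    also have "\<dots> = (\<integral>\<^sup>+s. ennreal (P0 s) * indicator A s + ennreal (P1 s) * indicator A s +
        ennreal (P2 s) * indicator A s \<partial>lborel)"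
      by (simp add: nn_integral_add)
    also have "\<dots> = (\<integral>\<^sup>+s. ennreal (g s) * indicator A s \<partial>lborel)"
      by (rule nn_integral_cong) (use Pnn in \<open>simp add: g_P split: split_indicator\<close>)
    finally show "emeasure (distr M lborel (\<lambda>\<omega>. \<xi>1 \<omega> * \<xi>2 \<omega>)) A =
      emeasure (density lborel (\<lambda>x. ennreal (g x))) A"
      by (simp add: emeasure_density)
  qed simp
  have prod_m: "(\<lambda>\<omega>. \<xi>1 \<omega> * \<xi>2 \<omega>) \<in> borel_measurable M"
    using \<xi>m by simp
  have g_density: "positive_density g"
    unfolding positive_density_def
  proof (intro conjI allI impI)
    show "g \<in> borel_measurable borel" by (rule gm)
    show "0 \<le> g x" for x using gpos[of x] by (cases "0 < x") (auto simp: g_def)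
    show "g x = 0" if "x \<le> 0" for x using that by (simp add: g_def)
    show "g x \<noteq> 0" if "0 < x" for x using gpos[OF that] by simp
    show "g C1_differentiable_on {0<..}"
      unfolding C1_differentiable_on_def
      by (intro exI[of _ g'] conjI ballI g'c) (use gd in \<open>simp add: has_real_derivative_iff_has_vector_derivative\<close>)
    have "emeasure M (space M) = emeasure (distr M lborel (\<lambda>\<omega>. \<xi>1 \<omega> * \<xi>2 \<omega>)) UNIV"
      using prod_m by (simp add: emeasure_distr)
    then show "(\<integral>\<^sup>+ x. ennreal (g x) \<partial>lborel) = 1"
      using prob_space.emeasure_space_1[OF prob] by (simp add: dg emeasure_density)
  qed

  \<comment> \<open>Oscillation of Lin's function\<close>
  have lin: "lin_fun g (D0 (of_int n)) = \<alpha> n * m n + \<beta> n" if n: "1 \<le> n" for n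
  proof -
    define s where "s = D0 (of_int n)"
    have n1: "1 \<le> real_of_int n" using n by simp
    have s: "0 < s" using D0pos n1 by (simp add: s_def)
    have E0s: "E0 s = of_int n" using E0(2) n1 by (simp add: s_def)
    \<comment> \<open>The distance \<open>e1 n\<close> from \<open>n\<close> lies between the
      half-width \<open>1 / c n\<close> of the bump and 1/2, so both \<open>w\<close> and its
      derivative vanish at this preimage.\<close>
    have z1: "w (E1 s) = 0 \<and> w' (E1 s) = 0"
      using wz[of n "E1 s"] e(1,2)[OF n] c(2)[OF n] mabs[OF n] by (simp add: e1_def s_def)
    have z2: "w (E2 s) = 0 \<and> w' (E2 s) = 0"
      using wz[of n "E2 s"] e(3,4)[OF n] c(3)[OF n] mabs[OF n] by (simp add: e2_def s_def)
    have "1 / \<bar>m n\<bar> \<le> 1 / 2" unfolding mabs[OF n] using e[OF n] c[OF n] by linarith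
    \<comment> \<open>The diagonal weight also contains \<open>w\<close> shifted by 1/2; the
      boundary distance 1/2 is still covered by the vanishing property.\<close>
    then have z3: "w (of_int n - 1/2) = 0 \<and> w' (of_int n - 1/2) = 0"
      using wz[of n "of_int n - 1/2"] by simp
    have p: "0 < p0 s" using pp0[OF s] .
    have k0n: "k0 (of_int n) = exp (- of_int n) * (15/16)"
      by (simp add: k0_def z3 wn[OF n])
    have k0'n: "k0' (of_int n) = exp (- of_int n) * (- m n / 16 - 15/16)"
      by (simp add: k0'_def k0n z3 wn[OF n] algebra_simps)
    have k1n: "k1 (E1 s) = 0" "k1 (E2 s) = 0" "k1' (E1 s) = 0" "k1' (E2 s) = 0"
      by (simp_all add: k1_def k1'_def z1 z2)
    have gs: "g s = exp (- of_int n) * (15/16) * p0 s"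
      using s by (simp add: g_def E0s k0n k1n)
    have gs': "g' s = exp (- of_int n) * (- m n / 16 - 15/16) * (p0 s)\<^sup>2 + exp (- of_int n) * (15/16) * q0 s"
      unfolding g'_def E0s k0n k0'n k1n by simp
    have "deriv g s = g' s" using DERIV_imp_deriv[OF gd[OF s]] .
    then have "lin_fun g s = - (s * g' s / g s)" by (simp add: lin_fun_def)
    \<comment> \<open>Only the diagonal terms survive. The exponential cancels, and
      \<open>- k0' / k0\<close> at \<open>n\<close> equals \<open>m n / 15 + 1\<close>.\<close>
    also have "\<dots> = s * p0 s / 15 * m n + (s * p0 s - s * q0 s / p0 s)"
      unfolding gs gs' using p by (simp add: field_simps power2_eq_square)
    finally show ?thesis by (simp add: \<alpha>_def \<beta>_def s_def)
  qed
  have up: "of_int n \<le> lin_fun g (D0 (of_int n))" if "1 \<le> n" "even n" for n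
    using lin[OF that(1)] c(4)[OF that(1)] that by (simp add: m_def)
  have down: "lin_fun g (D0 (of_int n)) \<le> - of_int n" if "1 \<le> n" "odd n" for n
    using lin[OF that(1)] c(4)[OF that(1)] that by (simp add: m_def)
  \<comment> \<open>Offsets 2 and 1 run through the even and the odd integers from the first
    positive one on; in both cases the integer is at least \<open>j\<close>.\<close>
  have limits: "filterlim (\<lambda>j. D0 (of_int (2 * int j + i))) at_top sequentially"
    if "0 \<le> i" for i
  proof (rule filterlim_compose[OF C2_diffeo_at_top[OF D0]])
    show "filterlim (\<lambda>j. real_of_int (2 * int j + i)) at_top sequentially"
      by (rule filterlim_at_top_mono[OF filterlim_real_sequentially]) (use that in simp)
  qed
  have "Limsup at_top (\<lambda>x. ereal (lin_fun g x)) = \<infinity>"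
  proof (rule Limsup_ereal_eq_PInfty[OF limits[of 2]])
    show "real j \<le> lin_fun g (D0 (of_int (2 * int j + 2)))" for j
      using up[of "2 * int j + 2"] by simp
  qed simp
  moreover have "Liminf at_top (\<lambda>x. ereal (lin_fun g x)) = - \<infinity>"
  proof (rule Liminf_ereal_eq_MInfty[OF limits[of 1]])
    show "lin_fun g (D0 (of_int (2 * int j + 1))) \<le> - real j" for j
      using down[of "2 * int j + 1"] by simp
  qed simp
  ultimately show ?thesis
    using prob \<xi>m singular d1 d2 dg g_density prod_m
    unfolding distributed_def
    by (intro exI[of _ M] exI[of _ \<xi>1] exI[of _ \<xi>2] exI[of _ g] conjI) simp_all
qed

end
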